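(* Let $\mathbb{K}$ be a number field whose ring of integers $O_{\mathbb{K}}$ is a Euclidean domain. For each integer $k\geq 2$ there is a number $M>0$ such that the following holds: for any $k$ distinct elements $b_1,\dots,b_k\in O_{\mathbb{K}}$ having equal norm Galois embeddings and with norm at least $M$, and for any choice of digits $d_j\in D_{b_j}$ ($1\le j\le k$), there are infinitely many $z\in O_{\mathbb{K}}$ such that for every $j\in\{1,\dots,k\}$, $z$ misses the digit $d_j$ in base $b_j$, i.e. $z=\sum_{l=0}^{m_j} r_l b_j^l$ for some $m_j\geq 0$ and digits $r_l\in D_{b_j}\setminus\{d_j\}$.
   Context: For a non-unit $b\in O_{\mathbb{K}}$, a digit set $D_b\subset O_{\mathbb{K}}$ is a complete set of representatives of the finite quotient $O_{\mathbb{K}}/bO_{\mathbb{K}}$ containing $0$ and $1$; concretely, identifying $\mathbb{K}$ with its image in $\mathbb{R}^s\times\mathbb{C}^t$ via the Galois (Minkowski) embeddings, $D_b$ consists of the elements of $O_{\mathbb{K}}$ lying in a half-open fundamental domain of the lattice $bO_{\mathbb{K}}$ spanned by $b\omega_1,\dots,b\omega_n$ for a fixed $\mathbb{Z}$-basis $\omega_1,\dots,\omega_n$ of $O_{\mathbb{K}}$ (for $\mathbb{K}=\mathbb{Q}(i)$ this is the square with vertices $0,b,ib,b+ib$). An element $b$ has equal norm Galois embeddings if $|\sigma(b)|$ is the same for all field embeddings $\sigma:\mathbb{K}\to\mathbb{C}$. The norm of $b$ is $|N_{\mathbb{K}/\mathbb{Q}}(b)|$. *)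

theory Defs
  imports
    Complex_Main
    "HOL-Computational_Algebra.Polynomial"
    "HOL-Algebra.Ring_Divisibility"
begin

text \<open>
  A number field is a type of class \<open>field_char_0\<close> that is finite-dimensional as a vector space
  over the rationals.
\<close>

definition number_field :: "'a::field_char_0 itself \<Rightarrow> bool" where
  "number_field T \<longleftrightarrow>
     (\<exists>B. finite_dimensional_vector_space (\<lambda>(q::rat) (x::'a). of_rat q * x) B)"

definition integers_of :: "'a::field_char_0 itself \<Rightarrow> 'a set" where
  "integers_of T = {x. algebraic_int x}"

definition ring_of_integers :: "'a::field_char_0 itself \<Rightarrow> 'a ring" where
  "ring_of_integers T =
     \<lparr>carrier = integers_of T, mult = (*), one = 1, zero = 0, add = (+)\<rparr>"

definition integral_basis :: "'a::field_char_0 set \<Rightarrow> bool" where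
  "integral_basis \<Omega> \<longleftrightarrow>
     finite \<Omega> \<and>
     \<not> Modules.module.dependent (\<lambda>(n::int) (x::'a). of_int n * x) \<Omega> \<and>
     Modules.module.span (\<lambda>(n::int) (x::'a). of_int n * x) \<Omega> = integers_of TYPE('a)"

definition embeddings :: "('a::field_char_0 \<Rightarrow> complex) set" where
  "embeddings =
     {\<sigma>. \<sigma> 1 = 1 \<and> (\<forall>x y. \<sigma> (x + y) = \<sigma> x + \<sigma> y) \<and> (\<forall>x y. \<sigma> (x * y) = \<sigma> x * \<sigma> y)}"

text \<open>
  The norm from the number field down to the rationals, as a complex number. The product is a
  genuine one, since a number field has only finitely many embeddings.
\<close>

definition field_norm :: "'a::field_char_0 \<Rightarrow> complex" where
  "field_norm x = (\<Prod>\<sigma>\<in>embeddings. \<sigma> x)"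

definition equal_norm_embeddings :: "'a::field_char_0 \<Rightarrow> bool" where
  "equal_norm_embeddings b \<longleftrightarrow>
     (\<forall>\<sigma>\<in>embeddings. \<forall>\<tau>\<in>embeddings. norm (\<sigma> b) = norm (\<tau> b))"

text \<open>
  The integers whose Minkowski image lies in the half-open parallelepiped spanned by the images
  of the elements \<open>b * w\<close>, where \<open>w\<close> ranges over the integral basis \<open>\<Omega>\<close>. The Minkowski image
  of \<open>x\<close> is given here by the values \<open>\<sigma> x\<close> at all complex embeddings; keeping both members of
  each conjugate pair does not affect the parallelepiped, because its coordinates \<open>t\<close> are real. This set always
  contains 0; it need not contain 1 (in the rationals with basis 1, take a negative \<open>b\<close>).
\<close>

definition digit_set :: "'a::field_char_0 set \<Rightarrow> 'a \<Rightarrow> 'a set" where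
  "digit_set \<Omega> b =
     {x \<in> integers_of TYPE('a). \<exists>t :: 'a \<Rightarrow> real.
        (\<forall>w\<in>\<Omega>. 0 \<le> t w \<and> t w < 1) \<and>
        (\<forall>\<sigma>\<in>embeddings. \<sigma> x = (\<Sum>w\<in>\<Omega>. complex_of_real (t w) * \<sigma> (b * w)))}"

definition misses_digit :: "'a::field_char_0 set \<Rightarrow> 'a \<Rightarrow> 'a \<Rightarrow> 'a \<Rightarrow> bool" where
  "misses_digit \<Omega> b d z \<longleftrightarrow>
     (\<exists>(m::nat) r. (\<forall>l\<le>m. r l \<in> digit_set \<Omega> b - {d}) \<and> z = (\<Sum>l\<le>m. r l * b ^ l))"

end

theory Submission
  imports
    Defs
    "HOL-Computational_Algebra.Fundamental_Theorem_Algebra"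
    "HOL-Analysis.Kronecker_Approximation_Theorem"
begin

text \<open>
  The maximum of the absolute values of all conjugates is a norm on the number field, for which
  multiplication by an element with equal norm embeddings is a similarity. The integers whose
  \<open>l\<close>-th digit in base \<open>b\<close> is a given \<open>d\<close> lie in a union of balls (holes) of radius
  proportional to \<open>r ^ l\<close>, where \<open>r\<close> is the common absolute value of the conjugates of \<open>b\<close>, and the
  centres of these balls are separated by a distance proportional to \<open>r ^ (l + 1)\<close>. If all \<open>r\<close> are
  large, then for each base a ball of radius \<open>R\<close> meets at most one hole of a size just below \<open>R\<close>,
  so one can choose a smaller ball inside that avoids all of them. Iterating leads to an integer
  that avoids all holes.

  The expansions of this integer must also be finite. By Dirichlet's simultaneous approximation
  theorem, the bases have arbitrarily large powers \<open>b j ^ n j\<close> whose quotients are close to 1 in all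
  embeddings. The \<open>n j\<close>-digit numbers then fill nearly the same parallelepiped for all bases, and
  the construction starts from a ball around its centre.

  That the coordinates with respect to an integral basis are bounded by the norm holds because
  every additive map from the number field to the complex numbers is a linear combination of
  embeddings. This passes from a field \<open>F\<close> to \<open>F(a)\<close> by Lagrange interpolation at the
  conjugates of \<open>a\<close>.
\<close>

hide_const (open) up_ring.coeff up_ring.monom module.smult

subsection \<open>Additive maps and embeddings\<close>

text \<open>Negatives come from the factor -1 and, for algebraic elements, inverses come for free,
  so such a set is then a field.\<close>

definition rational_subalgebra :: "'a::field_char_0 set \<Rightarrow> bool" where
  "rational_subalgebra F \<longleftrightarrow>
     \<rat> \<subseteq> F \<and> (\<forall>x\<in>F. \<forall>y\<in>F. x + y \<in> F \<and> x * y \<in> F)"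

definition coeffs_in :: "'a::field_char_0 set \<Rightarrow> 'a poly \<Rightarrow> bool" where
  "coeffs_in F p \<longleftrightarrow> (\<forall>i. coeff p i \<in> F)"

definition hom_on :: "'a::field_char_0 set \<Rightarrow> ('a \<Rightarrow> complex) \<Rightarrow> bool" where
  "hom_on F \<sigma> \<longleftrightarrow> \<sigma> 1 = 1 \<and> (\<forall>x\<in>F. \<forall>y\<in>F. \<sigma> (x + y) = \<sigma> x + \<sigma> y \<and> \<sigma> (x * y) = \<sigma> x * \<sigma> y)"

definition additive_on :: "'a::field_char_0 set \<Rightarrow> ('a \<Rightarrow> complex) \<Rightarrow> bool" where
  "additive_on F \<phi> \<longleftrightarrow> (\<forall>x\<in>F. \<forall>y\<in>F. \<phi> (x + y) = \<phi> x + \<phi> y)"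

text \<open>The ring \<open>F[a]\<close>. For a field \<open>F\<close> and algebraic
  \<open>a\<close> it is already the field \<open>F(a)\<close>.\<close>

definition adjoin :: "'a::field_char_0 set \<Rightarrow> 'a \<Rightarrow> 'a set" where
  "adjoin F a = {poly p a | p. coeffs_in F p}"

text \<open>The complex span of the homomorphisms on \<open>F\<close>. The inductive form makes each
  combination finite before it is known how many homomorphisms exist, and equalities are demanded on
  \<open>F\<close> only.\<close>

inductive hom_combination :: "'a::field_char_0 set \<Rightarrow> ('a \<Rightarrow> complex) \<Rightarrow> bool" for F where
  zero: "(\<And>x. x \<in> F \<Longrightarrow> \<phi> x = 0) \<Longrightarrow> hom_combination F \<phi>"
| step: "hom_on F \<sigma> \<Longrightarrow> hom_combination F \<psi> \<Longrightarrow> (\<And>x. x \<in> F \<Longrightarrow> \<phi> x = c * \<sigma> x + \<psi> x) \<Longrightarrow>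
    hom_combination F \<phi>"

text \<open>An additive map between rational vector spaces is linear over the rationals, so this
  says that the embeddings span the dual space with complex values.\<close>

definition spanned_by_homs :: "'a::field_char_0 set \<Rightarrow> bool" where
  "spanned_by_homs F \<longleftrightarrow> (\<forall>\<phi>. additive_on F \<phi> \<longrightarrow> hom_combination F \<phi>)"

lemma hom_combination_cong:
  assumes "hom_combination F \<phi>" "\<And>x. x \<in> F \<Longrightarrow> \<phi>' x = \<phi> x"
  shows "hom_combination F \<phi>'"
  using assms
proof (induction arbitrary: \<phi>' rule: hom_combination.induct)
  case (zero \<phi>)
  then show ?case by (intro hom_combination.zero) auto
next
  case (step \<sigma> \<psi> \<phi> c)
  show ?case
    by (rule hom_combination.step[OF step.hyps(1,2), where c = c]) (simp add: step.hyps(3) step.prems)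
qed

lemma hom_combination_add:
  assumes "hom_combination F \<phi>" "hom_combination F \<psi>"
  shows "hom_combination F (\<lambda>x. \<phi> x + \<psi> x)"
  using assms(1)
proof (induction rule: hom_combination.induct)
  case (zero \<phi>)
  then show ?case by (intro hom_combination_cong[OF assms(2)]) auto
next
  case (step \<sigma> \<kappa> \<phi> c)
  show ?case
    by (rule hom_combination.step[OF step.hyps(1) step.IH, where c = c]) (simp add: step.hyps(3))
qed

lemma hom_combination_scale:
  assumes "hom_combination F \<phi>"
  shows "hom_combination F (\<lambda>x. a * \<phi> x)"
  using assms
proof (induction rule: hom_combination.induct)
  case (zero \<phi>)
  then show ?case by (intro hom_combination.zero) auto
next
  case (step \<sigma> \<kappa> \<phi> c)
  show ?case
    by (rule hom_combination.step[OF step.hyps(1) step.IH, where c = "a * c"])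
      (simp add: step.hyps(3) algebra_simps)
qed

lemma hom_combination_hom: "hom_on F \<sigma> \<Longrightarrow> hom_combination F \<sigma>"
  by (rule hom_combination.step[where c = 1 and \<psi> = "\<lambda>_. 0"]) (auto intro: hom_combination.zero)

lemma hom_combination_sum:
  assumes "\<And>i. i \<in> I \<Longrightarrow> hom_combination F (\<phi> i)"
  shows "hom_combination F (\<lambda>x. \<Sum>i\<in>I. \<phi> i x)"
  using assms
  by (induction I rule: infinite_finite_induct) (auto intro: hom_combination.zero hom_combination_add)

section \<open>Coefficients of a polynomial from its values\<close>

lemma poly_eq_sum:
  fixes p :: "'a::comm_semiring_1 poly"
  assumes "degree p < m"
  shows "poly p x = (\<Sum>i<m. coeff p i * x ^ i)"
proof -
  have "(\<Sum>i\<le>degree p. coeff p i * x ^ i) = (\<Sum>i<m. coeff p i * x ^ i)"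
    using assms by (intro sum.mono_neutral_left) (auto simp: coeff_eq_0)
  then show ?thesis by (simp add: poly_altdef)
qed

text \<open>Lagrange interpolation, seen as a formula for the coefficients of a polynomial.\<close>

lemma coeff_interpolation:
  fixes Z :: "complex set"
  assumes "finite Z"
  shows "\<exists>\<delta>. \<forall>P. degree P < card Z \<longrightarrow> coeff P i = (\<Sum>z\<in>Z. \<delta> z * poly P z)"
proof -
  \<comment> \<open>The Lagrange basis polynomials; their \<open>i\<close>-th coefficients become
    the weights \<delta>.\<close>
  define L where "L z = smult (inverse (\<Prod>y\<in>Z - {z}. z - y)) (\<Prod>y\<in>Z - {z}. [:- y, 1:])" for z
  have deg_L: "degree (L z) < card Z" if "z \<in> Z" for z
  proof -
    have "degree (L z) \<le> degree (\<Prod>y\<in>Z - {z}. [:- y, 1:])" by (simp add: L_def)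
    also have "\<dots> \<le> (\<Sum>y\<in>Z - {z}. degree [:- y, 1:])" using degree_prod_sum_le[of "Z - {z}" "\<lambda>y. [:- y, 1:]"] assms by (simp add: o_def)
    also have "\<dots> = card Z - 1" using that assms by simp
    also have "\<dots> < card Z" using that assms card_gt_0_iff[of Z] by (intro diff_less) auto
    finally show ?thesis .
  qed
  have L_eq: "poly (L z) y = (if y = z then 1 else 0)" if "y \<in> Z" for y z
    using that assms by (auto simp: L_def poly_prod)
  have "coeff P i = (\<Sum>z\<in>Z. coeff (L z) i * poly P z)" if deg: "degree P < card Z" for P
  proof -
    define Q where "Q = (\<Sum>z\<in>Z. smult (poly P z) (L z))"
    have "P = Q"
    proof (cases "Z = {}")
      case False
      have "degree Q < card Z"
        unfolding Q_def
      proof (rule degree_sum_less)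
        show "degree (smult (poly P z) (L z)) < card Z" if "z \<in> Z" for z
          using deg_L[OF that] degree_smult_le le_less_trans by blast
      qed (use deg in simp)
      moreover have "poly P z = poly Q z" if "z \<in> Z" for z
      proof -
        have "poly Q z = (\<Sum>y\<in>Z. if z = y then poly P y else 0)"
          unfolding Q_def poly_sum using L_eq[OF that] by (intro sum.cong) auto
        then show ?thesis using that assms by simp
      qed
      ultimately show ?thesis using deg by (intro poly_eqI_degree[of Z]) auto
    qed (use deg in auto)
    then have "coeff P i = coeff Q i" by simp
    then show ?thesis by (simp add: Q_def coeff_sum mult.commute)
  qed
  then show ?thesis by (intro exI[of _ "\<lambda>z. coeff (L z) i"]) simp
qed

section \<open>Subalgebras over the rationals and polynomials over them\<close>

context
  fixes F :: "'a::field_char_0 set"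
  assumes F: "rational_subalgebra F"
begin

lemma subalgebra_add: "x \<in> F \<Longrightarrow> y \<in> F \<Longrightarrow> x + y \<in> F"
  and subalgebra_mult: "x \<in> F \<Longrightarrow> y \<in> F \<Longrightarrow> x * y \<in> F"
  and subalgebra_Rats: "q \<in> \<rat> \<Longrightarrow> q \<in> F"
  using F by (auto simp: rational_subalgebra_def)

lemma subalgebra_0: "0 \<in> F" and subalgebra_1: "1 \<in> F"
  by (simp_all add: subalgebra_Rats)

lemma subalgebra_minus: "x \<in> F \<Longrightarrow> - x \<in> F"
  using subalgebra_mult[of "-1" x] subalgebra_Rats[of "-1"] by simp

lemma subalgebra_diff: "x \<in> F \<Longrightarrow> y \<in> F \<Longrightarrow> x - y \<in> F"
  using subalgebra_add[of x "- y"] subalgebra_minus by simp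

lemma subalgebra_sum: "(\<And>i. i \<in> I \<Longrightarrow> f i \<in> F) \<Longrightarrow> sum f I \<in> F"
  by (induction I rule: infinite_finite_induct) (auto simp: subalgebra_0 subalgebra_add)

lemma subalgebra_power: "x \<in> F \<Longrightarrow> x ^ n \<in> F"
  by (induction n) (auto simp: subalgebra_1 subalgebra_mult)

lemma coeffs_in_add: "coeffs_in F p \<Longrightarrow> coeffs_in F q \<Longrightarrow> coeffs_in F (p + q)"
  by (simp add: coeffs_in_def subalgebra_add)

lemma coeffs_in_diff: "coeffs_in F p \<Longrightarrow> coeffs_in F q \<Longrightarrow> coeffs_in F (p - q)"
  by (simp add: coeffs_in_def subalgebra_diff)

lemma coeffs_in_mult: "coeffs_in F p \<Longrightarrow> coeffs_in F q \<Longrightarrow> coeffs_in F (p * q)"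
  by (simp add: coeffs_in_def coeff_mult subalgebra_sum subalgebra_mult)

lemma coeffs_in_monom: "c \<in> F \<Longrightarrow> coeffs_in F (monom c k)"
  by (simp add: coeffs_in_def subalgebra_0)

lemma coeffs_in_smult: "c \<in> F \<Longrightarrow> coeffs_in F p \<Longrightarrow> coeffs_in F (smult c p)"
  by (simp add: coeffs_in_def subalgebra_mult)

lemma coeffs_in_pderiv: "coeffs_in F p \<Longrightarrow> coeffs_in F (pderiv p)"
  by (simp add: coeffs_in_def coeff_pderiv subalgebra_mult subalgebra_Rats)

lemma coeffs_in_poly: "coeffs_in F p \<Longrightarrow> a \<in> F \<Longrightarrow> poly p a \<in> F"
  by (simp add: coeffs_in_def poly_altdef subalgebra_sum subalgebra_mult subalgebra_power)

lemma adjoin_subalgebra: "rational_subalgebra (adjoin F a)"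
  unfolding rational_subalgebra_def
proof (intro conjI subsetI ballI)
  fix x :: 'a assume "x \<in> \<rat>"
  then have "coeffs_in F [:x:]"
    using coeffs_in_monom[of x 0] subalgebra_Rats by (simp add: monom_0)
  then show "x \<in> adjoin F a" by (force simp: adjoin_def)
next
  fix x y assume "x \<in> adjoin F a" "y \<in> adjoin F a"
  then obtain p q where pq: "coeffs_in F p" "x = poly p a" "coeffs_in F q" "y = poly q a"
    by (auto simp: adjoin_def)
  have "x + y = poly (p + q) a" "x * y = poly (p * q) a" using pq by auto
  then show "x + y \<in> adjoin F a" "x * y \<in> adjoin F a"
    using coeffs_in_add coeffs_in_mult pq unfolding adjoin_def by blast+
qed

lemma adjoin_subset: "F \<subseteq> adjoin F a"
proof
  fix x assume "x \<in> F"
  then have "coeffs_in F [:x:]" using coeffs_in_monom[of x 0] by (simp add: monom_0)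
  then show "x \<in> adjoin F a" by (force simp: adjoin_def)
qed

lemma adjoin_generator: "a \<in> adjoin F a"
proof -
  have "coeffs_in F (monom 1 1)" using coeffs_in_monom subalgebra_1 by blast
  moreover have "poly (monom 1 1) a = a" by (simp add: poly_monom)
  ultimately show ?thesis unfolding adjoin_def by force
qed

text \<open>If \<open>\<Sum>i. coeff p i * x ^ i = 0\<close> with nonzero constant term, then \<open>1 / x\<close> is a polynomial in \<open>x\<close>.\<close>

lemma subalgebra_inverse:
  assumes "algebraic x" "x \<in> F"
  shows "inverse x \<in> F"
proof (cases "x = 0")
  case False
  obtain p :: "int poly" where p: "coeff p 0 \<noteq> 0" "poly (map_poly of_int p) x = 0"
    using algebraicE'_nonzero[OF assms(1) False] by metis
  obtain c q where cq: "map_poly of_int p = (pCons c q :: 'a poly)" by (cases "map_poly of_int p :: 'a poly")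
  have coeff: "coeff (pCons c q) i \<in> \<int>" for i by (simp flip: cq add: coeff_map_poly)
  have "c = of_int (coeff p 0)" using arg_cong[OF cq, of "\<lambda>p. coeff p 0"] by (simp add: coeff_map_poly)
  then have c: "c \<noteq> 0" "c \<in> \<rat>" using p by auto
  have "coeff q i \<in> \<rat>" for i using coeff[of "Suc i"] Ints_subset_Rats by auto
  then have "poly q x \<in> F" using assms(2) by (intro coeffs_in_poly) (auto simp: coeffs_in_def subalgebra_Rats)
  moreover have "c + x * poly q x = 0" using p(2) cq by simp
  then have "inverse x = - inverse c * poly q x"
    using False c by (simp add: field_simps add_eq_0_iff)
  ultimately show ?thesis using c by (simp add: subalgebra_mult subalgebra_minus subalgebra_Rats)
qed (simp add: subalgebra_0)

end

section \<open>Extending homomorphisms to a simple extension\<close>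

text \<open>Algebraicity makes \<open>F\<close> a field and gives a minimal polynomial over
  \<open>F\<close> to every element outside it.\<close>

locale algebraic_subfield =
  fixes F :: "'a::field_char_0 set"
  assumes subalgebra: "rational_subalgebra F"
    and all_algebraic: "\<And>x :: 'a. algebraic x"
begin

text \<open>Leading terms are cancelled by strong induction on the degree. Quotient and remainder
  keep their coefficients in \<open>F\<close> because the leading coefficient of \<open>g\<close>
  has its inverse there.\<close>

lemma divide_with_remainder:
  assumes g: "coeffs_in F g" "g \<noteq> 0"
  shows "coeffs_in F p \<Longrightarrow> \<exists>q s. coeffs_in F q \<and> coeffs_in F s \<and> p = q * g + s \<and> (s = 0 \<or> degree s < degree g)"
proof (induction "degree p" arbitrary: p rule: less_induct)
  case less
  show ?case
  proof (cases "p = 0 \<or> degree p < degree g")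
    case True
    then show ?thesis
      using less.prems subalgebra_0[OF subalgebra] by (intro exI[of _ 0] exI[of _ p]) (auto simp: coeffs_in_def)
  next
    case False
    define c where "c = lead_coeff p * inverse (lead_coeff g)"
    define t where "t = monom c (degree p - degree g)"
    have "c \<in> F" using less.prems g subalgebra_inverse[OF subalgebra all_algebraic] subalgebra_mult[OF subalgebra]
      by (simp add: c_def coeffs_in_def)
    then have t: "coeffs_in F t" unfolding t_def by (rule coeffs_in_monom[OF subalgebra])
    have "c \<noteq> 0" using False g by (simp add: c_def)
    have "degree t = degree p - degree g" unfolding t_def by (rule degree_monom_eq) fact
    moreover have "t \<noteq> 0" using \<open>c \<noteq> 0\<close> by (simp add: t_def)
    ultimately have deg: "degree (t * g) = degree p"
      using False g by (subst degree_mult_eq) auto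
    have "lead_coeff t = c" using \<open>degree t = _\<close> by (simp add: t_def)
    then have lc: "lead_coeff (t * g) = lead_coeff p"
      using g by (simp add: lead_coeff_mult c_def)
    have pF: "coeffs_in F (p - t * g)"
      using less.prems t g subalgebra by (intro coeffs_in_diff coeffs_in_mult)
    have "\<exists>q s. coeffs_in F q \<and> coeffs_in F s \<and> p - t * g = q * g + s \<and> (s = 0 \<or> degree s < degree g)"
    proof (cases "degree (p - t * g) < degree p")
      case True
      then show ?thesis using less.hyps pF by blast
    next
      case False
      \<comment> \<open>The leading coefficient has cancelled, so a difference whose degree does not
        drop must vanish; this happens only for constant \<open>p\<close>.\<close>
      have "degree (p - t * g) \<le> degree p" by (rule degree_diff_le) (use deg in auto)
      moreover have "coeff (p - t * g) (degree p) = 0" using lc deg by simp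
      ultimately have "p - t * g = 0" using False
        by (metis le_antisym leading_coeff_0_iff linorder_not_le)
      then show ?thesis
        using subalgebra_0[OF subalgebra] by (intro exI[of _ 0] exI[of _ 0]) (auto simp: coeffs_in_def)
    qed
    then obtain q s where "coeffs_in F q" "coeffs_in F s" "p - t * g = q * g + s" "s = 0 \<or> degree s < degree g" by blast
    then show ?thesis
      using t coeffs_in_add[OF subalgebra]
      by (intro exI[of _ "q + t"] exI[of _ s]) (auto simp: algebra_simps)
  qed
qed

lemma inverse_closed: "x \<in> F \<Longrightarrow> inverse x \<in> F"
  by (rule subalgebra_inverse[OF subalgebra all_algebraic])

text \<open>A nonzero polynomial over \<open>F\<close> of least degree with root \<open>a\<close>,
  scaled to be monic. One exists since \<open>a\<close> is algebraic over the rationals, which lie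
  in \<open>F\<close>.\<close>

lemma minimal_polynomial:
  obtains m where "coeffs_in F m" "lead_coeff m = 1" "poly m a = 0"
    "\<And>p. coeffs_in F p \<Longrightarrow> p \<noteq> 0 \<Longrightarrow> poly p a = 0 \<Longrightarrow> degree m \<le> degree p"
proof -
  define P where "P p \<longleftrightarrow> coeffs_in F p \<and> p \<noteq> 0 \<and> poly p a = 0" for p
  obtain p0 where "(\<forall>i. coeff p0 i \<in> \<rat>)" "p0 \<noteq> 0" "poly p0 a = 0"
    using all_algebraic[of a] by (auto simp: algebraic_altdef)
  then have "P p0" by (auto simp: P_def coeffs_in_def subalgebra_Rats[OF subalgebra])
  then obtain p where p: "P p" "\<And>q. P q \<Longrightarrow> degree p \<le> degree q"
    by (metis ex_has_least_nat)
  show ?thesis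
  proof (rule that)
    show "coeffs_in F (smult (inverse (lead_coeff p)) p)"
      using p(1) by (intro coeffs_in_smult[OF subalgebra] inverse_closed) (auto simp: P_def coeffs_in_def)
    show "degree (smult (inverse (lead_coeff p)) p) \<le> degree q"
      if "coeffs_in F q" "q \<noteq> 0" "poly q a = 0" for q
      using p that by (simp add: P_def)
  qed (use p in \<open>auto simp: P_def\<close>)
qed

context
  fixes \<tau> :: "'a \<Rightarrow> complex"
  assumes hom: "hom_on F \<tau>"
begin

lemma hom_add: "x \<in> F \<Longrightarrow> y \<in> F \<Longrightarrow> \<tau> (x + y) = \<tau> x + \<tau> y"
  and hom_mult: "x \<in> F \<Longrightarrow> y \<in> F \<Longrightarrow> \<tau> (x * y) = \<tau> x * \<tau> y"
  and hom_1: "\<tau> 1 = 1"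
  using hom by (auto simp: hom_on_def)

lemma hom_0: "\<tau> 0 = 0"
  using hom_add[of 0 0] subalgebra_0[OF subalgebra] by simp

lemma hom_eq_0: "x \<in> F \<Longrightarrow> \<tau> x = 0 \<Longrightarrow> x = 0"
  using hom_mult[of x "inverse x"] hom_1 inverse_closed[of x] by (cases "x = 0") auto

lemma hom_sum: "(\<And>i. i \<in> I \<Longrightarrow> f i \<in> F) \<Longrightarrow> \<tau> (sum f I) = (\<Sum>i\<in>I. \<tau> (f i))"
  by (induction I rule: infinite_finite_induct) (auto simp: hom_0 hom_add subalgebra_sum[OF subalgebra])

lemma hom_of_nat: "\<tau> (of_nat k) = of_nat k"
proof (induction k)
  case (Suc k)
  then show ?case
    using hom_add[of 1 "of_nat k"] hom_1 subalgebra_1[OF subalgebra] subalgebra_Rats[OF subalgebra, of "of_nat k"] by simp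
qed (simp add: hom_0)

lemma map_poly_hom_mult:
  assumes "coeffs_in F p" "coeffs_in F q"
  shows "map_poly \<tau> (p * q) = map_poly \<tau> p * map_poly \<tau> q"
  using assms by (intro poly_eqI)
    (simp add: coeff_map_poly hom_0 coeff_mult hom_sum hom_mult coeffs_in_def subalgebra_mult[OF subalgebra])

lemma map_poly_hom_add:
  assumes "coeffs_in F p" "coeffs_in F q"
  shows "map_poly \<tau> (p + q) = map_poly \<tau> p + map_poly \<tau> q"
  using assms by (intro poly_eqI) (simp add: coeff_map_poly hom_0 hom_add coeffs_in_def)

lemma map_poly_hom_pderiv:
  assumes "coeffs_in F p"
  shows "map_poly \<tau> (pderiv p) = pderiv (map_poly \<tau> p)"
proof (intro poly_eqI)
  fix i
  have "of_nat (Suc i) \<in> F" using subalgebra_Rats[OF subalgebra] by (metis Rats_of_nat)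
  moreover have "coeff p (Suc i) \<in> F" using assms by (simp add: coeffs_in_def)
  ultimately show "coeff (map_poly \<tau> (pderiv p)) i = coeff (pderiv (map_poly \<tau> p)) i"
    by (simp only: coeff_map_poly[of \<tau>, OF hom_0] coeff_pderiv hom_mult hom_of_nat)
qed

lemma map_poly_hom_eq_0:
  assumes "coeffs_in F p" "map_poly \<tau> p = 0"
  shows "p = 0"
proof (rule poly_eqI)
  fix i
  have "\<tau> (coeff p i) = 0"
    using arg_cong[OF assms(2), of "\<lambda>p. coeff p i"] by (simp add: coeff_map_poly hom_0)
  then show "coeff p i = coeff 0 i"
    using assms(1) hom_eq_0 by (simp add: coeffs_in_def)
qed

lemma poly_map_hom_const: "poly (map_poly \<tau> [:c:]) \<rho> = \<tau> c"
  by (simp add: map_poly_pCons hom_0)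

context
  fixes m :: "'a poly" and a :: 'a
  assumes m: "coeffs_in F m" "lead_coeff m = 1" "poly m a = 0"
    and minimal: "\<And>p. coeffs_in F p \<Longrightarrow> p \<noteq> 0 \<Longrightarrow> poly p a = 0 \<Longrightarrow> degree m \<le> degree p"
begin

lemma m_nonzero: "m \<noteq> 0"
  using m(2) by auto

lemma degree_map_poly_m: "degree (map_poly \<tau> m) = degree m"
  by (rule map_poly_degree_eq) (use m(2) hom_1 in simp)

text \<open>
  A polynomial of least degree over \<open>F\<close> whose image under \<open>\<tau>\<close> vanishes at a double root would be a
  proper divisor of the minimal polynomial.
\<close>

lemma rsquarefree_map_poly_m: "rsquarefree (map_poly \<tau> m)"
  unfolding rsquarefree_roots
proof (intro allI notI, elim conjE)
  fix \<rho> assume root: "poly (map_poly \<tau> m) \<rho> = 0" and root': "poly (pderiv (map_poly \<tau> m)) \<rho> = 0"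
  define P where "P p \<longleftrightarrow> coeffs_in F p \<and> p \<noteq> 0 \<and> poly (map_poly \<tau> p) \<rho> = 0" for p
  have pos: "degree (map_poly \<tau> m) \<noteq> 0"
  proof
    assume "degree (map_poly \<tau> m) = 0"
    then obtain c where c: "map_poly \<tau> m = [:c:]" using degree_eq_zeroE by blast
    then have "map_poly \<tau> m = 0" using root by simp
    then show False using map_poly_hom_eq_0[OF m(1)] m_nonzero by simp
  qed
  \<comment> \<open>The derivative is nonzero in characteristic 0, so it pushes the least degree
    below that of \<open>m\<close>.\<close>
  have "P (pderiv m)"
    using root' map_poly_hom_pderiv[OF m(1)] coeffs_in_pderiv[OF subalgebra m(1)] pos degree_map_poly_m
    by (auto simp: P_def pderiv_eq_0_iff)
  then obtain g where g: "P g" "\<And>q. P q \<Longrightarrow> degree g \<le> degree q"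
    by (metis ex_has_least_nat)
  have gF: "coeffs_in F g" "g \<noteq> 0" "poly (map_poly \<tau> g) \<rho> = 0" using g(1) by (auto simp: P_def)
  have "degree g \<le> degree m - 1"
    using g(2)[OF \<open>P (pderiv m)\<close>] by (simp add: degree_pderiv)
  then have deg_less: "degree g < degree m" using pos degree_map_poly_m by simp
  obtain q s where qs: "coeffs_in F q" "coeffs_in F s" "m = q * g + s" "s = 0 \<or> degree s < degree g"
    using divide_with_remainder[OF gF(1,2) m(1)] by blast
  have "map_poly \<tau> m = map_poly \<tau> q * map_poly \<tau> g + map_poly \<tau> s"
    using qs gF map_poly_hom_add map_poly_hom_mult coeffs_in_mult[OF subalgebra] by metis
  then have "poly (map_poly \<tau> s) \<rho> = 0" using root gF(3) by simp
  then have "s \<noteq> 0 \<Longrightarrow> P s" using qs(2) by (simp add: P_def)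
  then have "s = 0" using g(2)[of s] qs(4) by (meson not_less)
  then have mqg: "m = q * g" using qs(3) by simp
  then have "q \<noteq> 0" using m_nonzero by auto
  \<comment> \<open>As \<open>g\<close> cannot vanish at \<open>a\<close>, the cofactor
    \<open>q\<close> must, which forces it to have full degree. Then \<open>g\<close> is a nonzero
    constant, and \<tau> cannot send it to 0.\<close>
  have "poly g a \<noteq> 0" using minimal[OF gF(1,2)] deg_less by auto
  then have "poly q a = 0" using m(3) mqg by simp
  then have "degree m \<le> degree q" using minimal[OF qs(1) \<open>q \<noteq> 0\<close>] by simp
  then have "degree g = 0" using degree_mult_eq[OF \<open>q \<noteq> 0\<close> gF(2)] mqg by simp
  then obtain c where c: "g = [:c:]" using degree_eq_zeroE by blast
  then have "\<tau> c = 0" using gF(3) poly_map_hom_const by simp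
  moreover have "c \<in> F" using gF(1) c unfolding coeffs_in_def by (metis coeff_pCons_0)
  ultimately show False using hom_eq_0 c gF(2) by simp
qed

text \<open>Over the complex numbers a squarefree polynomial is, up to a constant, a product of
  distinct linear factors, one for each root.\<close>

lemma card_roots: "card {\<rho>. poly (map_poly \<tau> m) \<rho> = 0} = degree m"
proof -
  let ?f = "map_poly \<tau> m"
  have "?f = smult (lead_coeff ?f) (\<Prod>z | poly ?f z = 0. [:- z, 1:])"
    using complex_poly_decompose_rsquarefree[OF rsquarefree_map_poly_m] by simp
  moreover have "?f \<noteq> 0" using map_poly_hom_eq_0[OF m(1)] m_nonzero by blast
  ultimately have "degree ?f = degree (\<Prod>z | poly ?f z = 0. [:- z, 1:])"
    by (metis degree_smult_eq leading_coeff_0_iff)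
  also have "\<dots> = (\<Sum>z | poly ?f z = 0. degree [:- z, 1:])"
    by (rule degree_prod_eq_sum_degree) auto
  finally show ?thesis using degree_map_poly_m by simp
qed

text \<open>A polynomial over \<open>F\<close> with root \<open>a\<close> is a multiple of
  \<open>m\<close>, as its remainder would otherwise contradict minimality.\<close>

lemma poly_map_eq_0:
  assumes "poly (map_poly \<tau> m) \<rho> = 0" "coeffs_in F p" "poly p a = 0"
  shows "poly (map_poly \<tau> p) \<rho> = 0"
proof -
  obtain q s where qs: "coeffs_in F q" "coeffs_in F s" "p = q * m + s" "s = 0 \<or> degree s < degree m"
    using divide_with_remainder[OF m(1) m_nonzero assms(2)] by blast
  have "poly s a = 0" using qs(3) assms(3) m(3) by simp
  then have "s = 0" using minimal[OF qs(2)] qs(4) by (meson not_less)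
  then have "map_poly \<tau> p = map_poly \<tau> q * map_poly \<tau> m"
    using qs map_poly_hom_mult[OF qs(1) m(1)] by simp
  then show ?thesis using assms(1) by simp
qed

text \<open>\<open>F[a]\<close> is \<open>F[X]\<close> modulo \<open>m\<close>, so \<open>a\<close>
  may be sent to any root of the image of \<open>m\<close>.\<close>

lemma hom_extension:
  assumes root: "poly (map_poly \<tau> m) \<rho> = 0"
  shows "\<exists>\<sigma>. hom_on (adjoin F a) \<sigma> \<and> (\<forall>p. coeffs_in F p \<longrightarrow> \<sigma> (poly p a) = poly (map_poly \<tau> p) \<rho>)"
proof -
  \<comment> \<open>An arbitrary polynomial representing \<open>x\<close> is picked; by
    \<open>poly_map_eq_0\<close> any other choice gives the same value.\<close>
  define \<sigma> where "\<sigma> x = poly (map_poly \<tau> (SOME p. coeffs_in F p \<and> poly p a = x)) \<rho>" for x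
  have \<sigma>: "\<sigma> (poly p a) = poly (map_poly \<tau> p) \<rho>" if p: "coeffs_in F p" for p
  proof -
    define q where "q = (SOME q. coeffs_in F q \<and> poly q a = poly p a)"
    have q: "coeffs_in F q" "poly q a = poly p a"
      using someI[of "\<lambda>q. coeffs_in F q \<and> poly q a = poly p a" p] p by (auto simp: q_def)
    have d: "coeffs_in F (q - p)" using q p by (intro coeffs_in_diff[OF subalgebra])
    have "poly (map_poly \<tau> (q - p)) \<rho> = 0" using poly_map_eq_0[OF root d] q by simp
    then have "poly (map_poly \<tau> (q - p + p)) \<rho> = poly (map_poly \<tau> p) \<rho>"
      using map_poly_hom_add[OF d p] by simp
    then show ?thesis by (simp add: \<sigma>_def q_def)
  qed
  have "hom_on (adjoin F a) \<sigma>"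
    unfolding hom_on_def
  proof (intro conjI ballI)
    have "coeffs_in F [:1:]"
      using coeffs_in_monom[OF subalgebra subalgebra_1[OF subalgebra], of 0] by (simp add: monom_0)
    then show "\<sigma> 1 = 1" using \<sigma>[of "[:1:]"] poly_map_hom_const hom_1 by simp
  next
    fix x y assume "x \<in> adjoin F a" "y \<in> adjoin F a"
    then obtain p q where pq: "coeffs_in F p" "coeffs_in F q" "x = poly p a" "y = poly q a"
      by (auto simp: adjoin_def)
    show "\<sigma> (x + y) = \<sigma> x + \<sigma> y"
      using \<sigma>[OF coeffs_in_add[OF subalgebra pq(1,2)]] \<sigma> pq map_poly_hom_add[OF pq(1,2)] by simp
    show "\<sigma> (x * y) = \<sigma> x * \<sigma> y"
      using \<sigma>[OF coeffs_in_mult[OF subalgebra pq(1,2)]] \<sigma> pq map_poly_hom_mult[OF pq(1,2)] by simp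
  qed
  then show ?thesis using \<sigma> by blast
qed

text \<open>The extended homomorphisms evaluated at \<open>poly p a\<close> give the values of the
  image of \<open>p\<close> at the conjugates \<rho>. There are \<open>degree m\<close> conjugates,
  enough for interpolation to recover a coefficient as a fixed combination of these values.\<close>

lemma hom_coeff_functional:
  "\<exists>\<kappa>. hom_combination (adjoin F a) \<kappa> \<and>
     (\<forall>p. coeffs_in F p \<longrightarrow> degree p < degree m \<longrightarrow> \<kappa> (poly p a) = \<tau> (coeff p i))"
proof -
  define Z where "Z = {\<rho>. poly (map_poly \<tau> m) \<rho> = 0}"
  have "map_poly \<tau> m \<noteq> 0" using map_poly_hom_eq_0[OF m(1)] m_nonzero by blast
  then have fin: "finite Z" unfolding Z_def by (rule poly_roots_finite)
  obtain \<delta> where \<delta>: "\<And>P. degree P < card Z \<Longrightarrow> coeff P i = (\<Sum>z\<in>Z. \<delta> z * poly P z)"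
    using coeff_interpolation[OF fin] by metis
  have "\<forall>\<rho>\<in>Z. \<exists>\<sigma>. hom_on (adjoin F a) \<sigma> \<and> (\<forall>p. coeffs_in F p \<longrightarrow> \<sigma> (poly p a) = poly (map_poly \<tau> p) \<rho>)"
    using hom_extension by (auto simp: Z_def)
  then obtain \<sigma> where \<sigma>: "\<And>\<rho>. \<rho> \<in> Z \<Longrightarrow> hom_on (adjoin F a) (\<sigma> \<rho>)"
      "\<And>\<rho> p. \<rho> \<in> Z \<Longrightarrow> coeffs_in F p \<Longrightarrow> \<sigma> \<rho> (poly p a) = poly (map_poly \<tau> p) \<rho>"
    by metis
  define \<kappa> where "\<kappa> x = (\<Sum>\<rho>\<in>Z. \<delta> \<rho> * \<sigma> \<rho> x)" for x
  have "hom_combination (adjoin F a) \<kappa>"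
    unfolding \<kappa>_def by (intro hom_combination_sum hom_combination_scale hom_combination_hom \<sigma>)
  moreover have "\<kappa> (poly p a) = \<tau> (coeff p i)" if p: "coeffs_in F p" "degree p < degree m" for p
  proof -
    have "degree (map_poly \<tau> p) < card Z"
      using map_poly_degree_leq[of \<tau> p] p(2) card_roots by (simp add: Z_def)
    then have "coeff (map_poly \<tau> p) i = \<kappa> (poly p a)"
      unfolding \<kappa>_def using \<delta> \<sigma>(2) p(1) by simp
    then show ?thesis by (simp add: coeff_map_poly hom_0)
  qed
  ultimately show ?thesis by blast
qed

end

end

lemma coeff_functional:
  assumes m: "coeffs_in F m" "lead_coeff m = 1" "poly m a = 0"
    and minimal: "\<And>p. coeffs_in F p \<Longrightarrow> p \<noteq> 0 \<Longrightarrow> poly p a = 0 \<Longrightarrow> degree m \<le> degree p"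
    and "hom_combination F \<psi>"
  shows "\<exists>\<kappa>. hom_combination (adjoin F a) \<kappa> \<and>
     (\<forall>p. coeffs_in F p \<longrightarrow> degree p < degree m \<longrightarrow> \<kappa> (poly p a) = \<psi> (coeff p i))"
  using assms(5)
proof (induction rule: hom_combination.induct)
  case (zero \<phi>)
  then show ?case
    by (intro exI[of _ "\<lambda>_. 0"]) (auto simp: coeffs_in_def intro: hom_combination.zero)
next
  case (step \<sigma> \<psi> \<phi> c)
  obtain \<kappa>1 where \<kappa>1: "hom_combination (adjoin F a) \<kappa>1"
      "\<And>p. coeffs_in F p \<Longrightarrow> degree p < degree m \<Longrightarrow> \<kappa>1 (poly p a) = \<sigma> (coeff p i)"
    using hom_coeff_functional[OF step.hyps(1) m minimal] by blast
  obtain \<kappa>2 where \<kappa>2: "hom_combination (adjoin F a) \<kappa>2"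
      "\<And>p. coeffs_in F p \<Longrightarrow> degree p < degree m \<Longrightarrow> \<kappa>2 (poly p a) = \<psi> (coeff p i)"
    using step.IH by blast
  have "hom_combination (adjoin F a) (\<lambda>x. c * \<kappa>1 x + \<kappa>2 x)"
    using \<kappa>1 \<kappa>2 by (intro hom_combination_add hom_combination_scale)
  then show ?case
    using \<kappa>1(2) \<kappa>2(2) step.hyps(3) by (intro exI[of _ "\<lambda>x. c * \<kappa>1 x + \<kappa>2 x"]) (auto simp: coeffs_in_def)
qed

text \<open>In terms of the powers of \<open>a\<close>, an additive map splits into summands that
  depend additively on a single coefficient. By assumption each is a combination of homomorphisms of
  \<open>F\<close> in that coefficient, and \<open>coeff_functional\<close> lifts it to
  \<open>F[a]\<close>.\<close>

lemma spanned_by_homs_adjoin: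
  assumes "spanned_by_homs F"
  shows "spanned_by_homs (adjoin F a)"
  unfolding spanned_by_homs_def
proof (intro allI impI)
  fix \<phi> assume \<phi>: "additive_on (adjoin F a) \<phi>"
  obtain m where m: "coeffs_in F m" "lead_coeff m = 1" "poly m a = 0"
    "\<And>p. coeffs_in F p \<Longrightarrow> p \<noteq> 0 \<Longrightarrow> poly p a = 0 \<Longrightarrow> degree m \<le> degree p"
    using minimal_polynomial by metis
  have "m \<noteq> 0" using m(2) by auto
  have pos: "degree m \<noteq> 0"
  proof
    assume "degree m = 0"
    then obtain c where "m = [:c:]" using degree_eq_zeroE by blast
    then show False using m(2,3) by simp
  qed
  have sub: "rational_subalgebra (adjoin F a)" by (rule adjoin_subalgebra[OF subalgebra])
  have closed: "c * a ^ i \<in> adjoin F a" if "c \<in> F" for c i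
    using that adjoin_subset[OF subalgebra] adjoin_generator[OF subalgebra]
    by (intro subalgebra_mult[OF sub] subalgebra_power[OF sub]) auto
  have "hom_combination F (\<lambda>c. \<phi> (c * a ^ i))" for i
  proof -
    have "additive_on F (\<lambda>c. \<phi> (c * a ^ i))"
      using \<phi> closed by (auto simp: additive_on_def distrib_right)
    then show ?thesis using assms by (simp add: spanned_by_homs_def)
  qed
  then have "\<forall>i. \<exists>\<kappa>. hom_combination (adjoin F a) \<kappa> \<and>
     (\<forall>p. coeffs_in F p \<longrightarrow> degree p < degree m \<longrightarrow> \<kappa> (poly p a) = \<phi> (coeff p i * a ^ i))"
    by (intro allI coeff_functional[OF m(1,2,3)] m(4))
  from choice[OF this] obtain \<kappa> where \<kappa>: "\<And>i. hom_combination (adjoin F a) (\<kappa> i)"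
      "\<And>i p. coeffs_in F p \<Longrightarrow> degree p < degree m \<Longrightarrow> \<kappa> i (poly p a) = \<phi> (coeff p i * a ^ i)"
    by blast
  have \<phi>0: "\<phi> 0 = 0"
    using \<phi> subalgebra_0[OF sub] unfolding additive_on_def by (metis add.right_neutral add_left_cancel)
  have \<phi>_sum: "\<phi> (\<Sum>i<k. coeff p i * a ^ i) = (\<Sum>i<k. \<phi> (coeff p i * a ^ i))"
    if "coeffs_in F p" for p and k :: nat
  proof (induction k)
    case (Suc k)
    have "(\<Sum>i<k. coeff p i * a ^ i) \<in> adjoin F a"
      using that by (intro subalgebra_sum[OF sub] closed) (simp add: coeffs_in_def)
    moreover have "coeff p k * a ^ k \<in> adjoin F a" using that closed by (simp add: coeffs_in_def)
    ultimately show ?case using \<phi> Suc by (simp add: additive_on_def)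
  qed (simp add: \<phi>0)
  show "hom_combination (adjoin F a) \<phi>"
  proof (rule hom_combination_cong)
    show "hom_combination (adjoin F a) (\<lambda>x. \<Sum>i<degree m. \<kappa> i x)"
      by (rule hom_combination_sum) (rule \<kappa>)
    fix x assume "x \<in> adjoin F a"
    then obtain p where p: "coeffs_in F p" "x = poly p a" by (auto simp: adjoin_def)
    obtain q s where qs: "coeffs_in F q" "coeffs_in F s" "p = q * m + s" "s = 0 \<or> degree s < degree m"
      using divide_with_remainder[OF m(1) \<open>m \<noteq> 0\<close> p(1)] by blast
    have x: "x = poly s a" using p qs m by simp
    \<comment> \<open>The zero remainder has degree 0 and is covered because \<open>m\<close> is not
      constant.\<close>
    have deg: "degree s < degree m" using qs(4) pos by auto
    then show "\<phi> x = (\<Sum>i<degree m. \<kappa> i x)"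
      using \<phi>_sum[OF qs(2)] \<kappa>(2)[OF qs(2) deg] poly_eq_sum[OF deg, of a] x by simp
  qed
qed

end

section \<open>From the rationals to a number field\<close>

lemma additive_rat_linear:
  fixes g :: "rat \<Rightarrow> complex"
  assumes add: "\<And>x y. g (x + y) = g x + g y"
  shows "g q = g 1 * of_rat q"
proof -
  have g0: "g 0 = 0" using add[of 0 0] by simp
  have nat: "g (of_nat k * x) = of_nat k * g x" for k x
    by (induction k) (simp_all add: g0 add distrib_right)
  have neg: "g (- x) = - g x" for x using add[of x "- x"] g0 by (simp add: eq_neg_iff_add_eq_0 add.commute)
  have int: "g (of_int k * x) = of_int k * g x" for k x
    using nat neg by (cases k rule: int_cases2) (simp_all)
  obtain a b where q: "q = of_int a / of_int b" "b > 0"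
    by (metis Fract_of_int_quotient Rat_cases)
  have "of_int b * q = of_int a * 1" using q by simp
  then have "of_int b * g q = g (of_int a * 1)" using int[of b q] by metis
  also have "\<dots> = of_int a * g 1" by (rule int)
  finally have "g q = of_int a / of_int b * g 1"
    using \<open>b > 0\<close> by (simp add: eq_divide_eq mult.commute)
  then show ?thesis using q by (simp add: of_rat_divide mult.commute)
qed

lemma spanned_by_homs_Rats: "spanned_by_homs (\<rat> :: 'a::field_char_0 set)"
  unfolding spanned_by_homs_def
proof (intro allI impI)
  fix \<phi> :: "'a \<Rightarrow> complex" assume \<phi>: "additive_on \<rat> \<phi>"
  \<comment> \<open>The identification of the rationals inside \<open>'a\<close> with those inside
    the complex numbers; values elsewhere are arbitrary.\<close>
  define \<sigma> :: "'a \<Rightarrow> complex" where "\<sigma> x = of_rat (THE q. x = of_rat q)" for x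
  have \<sigma>: "\<sigma> (of_rat q) = of_rat q" for q by (simp add: \<sigma>_def)
  have "hom_on \<rat> \<sigma>"
    unfolding hom_on_def
  proof (intro conjI ballI)
    show "\<sigma> 1 = 1" using \<sigma>[of 1] by simp
    fix x y :: 'a assume "x \<in> \<rat>" "y \<in> \<rat>"
    then obtain p q where "x = of_rat p" "y = of_rat q" by (auto elim!: Rats_cases)
    then show "\<sigma> (x + y) = \<sigma> x + \<sigma> y" "\<sigma> (x * y) = \<sigma> x * \<sigma> y"
      using \<sigma>[of "p + q"] \<sigma>[of "p * q"] \<sigma> by (simp_all add: of_rat_add of_rat_mult)
  qed
  then have comb: "hom_combination \<rat> (\<lambda>x. \<phi> 1 * \<sigma> x)"
    by (intro hom_combination_scale hom_combination_hom)
  have "\<phi> x = \<phi> 1 * \<sigma> x" if "x \<in> \<rat>" for x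
  proof -
    obtain q where x: "x = of_rat q" using \<open>x \<in> \<rat>\<close> by (auto elim!: Rats_cases)
    have "\<phi> (of_rat q) = \<phi> (of_rat 1) * of_rat q"
      by (rule additive_rat_linear) (use \<phi> in \<open>auto simp: additive_on_def of_rat_add\<close>)
    then show ?thesis using x \<sigma> by simp
  qed
  then show "hom_combination \<rat> \<phi>" by (rule hom_combination_cong[OF comb])
qed

text \<open>The elements of \<open>B\<close> are adjoined one at a time, starting from the
  rationals.\<close>

lemma spanned_by_homs_superset:
  assumes "\<And>x :: 'a::field_char_0. algebraic x" "finite B"
  shows "\<exists>F :: 'a set. rational_subalgebra F \<and> B \<subseteq> F \<and> spanned_by_homs F"
  using assms(2)
proof (induction rule: finite_induct)
  case empty
  have "rational_subalgebra (\<rat> :: 'a set)" by (simp add: rational_subalgebra_def)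
  then show ?case using spanned_by_homs_Rats by blast
next
  case (insert a B)
  then obtain F :: "'a set" where F: "rational_subalgebra F" "B \<subseteq> F" "spanned_by_homs F" by blast
  interpret algebraic_subfield F using F(1) assms(1) by unfold_locales
  show ?case
    using spanned_by_homs_adjoin[OF F(3), of a] adjoin_subalgebra[OF F(1)] adjoin_subset[OF F(1)]
      adjoin_generator[OF F(1), of a] F(2) by (intro exI[of _ "adjoin F a"]) blast
qed

text \<open>In finite dimension the powers of \<open>x\<close> are dependent, which is a polynomial
  relation. Repeated powers form a case of their own, since dependence concerns the set of powers
  and does not see multiplicities.\<close>

lemma number_field_algebraic:
  assumes "number_field TYPE('a::field_char_0)"
  shows "algebraic (x :: 'a)"
proof -
  obtain B where "finite_dimensional_vector_space (\<lambda>(q::rat) (x::'a). of_rat q * x) B"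
    using assms by (auto simp: number_field_def)
  then interpret V: finite_dimensional_vector_space "\<lambda>(q::rat) (x::'a). of_rat q * x" B .
  show ?thesis
  proof (cases "inj ((^) x)")
    case False
    then obtain i j where ij: "x ^ i = x ^ j" "i \<noteq> j" by (auto simp: inj_def)
    show ?thesis
    proof (rule algebraicI')
      show "coeff (monom 1 i - monom 1 j :: 'a poly) k \<in> \<rat>" for k by simp
      show "monom 1 i - monom 1 j \<noteq> (0 :: 'a poly)"
        using ij(2) by (auto simp: poly_eq_iff intro!: exI[of _ i])
      show "poly (monom 1 i - monom 1 j) x = 0" using ij(1) by (simp add: poly_monom)
    qed
  next
    case True
    then have "V.dependent (range ((^) x))"
      using V.finiteI_independent range_inj_infinite by blast
    then obtain T u where T: "finite T" "T \<subseteq> range ((^) x)" "(\<Sum>v\<in>T. of_rat (u v) * v) = 0"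
        "\<exists>v\<in>T. u v \<noteq> 0"
      unfolding V.dependent_explicit by blast
    obtain I where I: "finite I" "T = (^) x ` I" using finite_subset_image[OF T(1,2)] by blast
    define p where "p = (\<Sum>i\<in>I. monom (of_rat (u (x ^ i)) :: 'a) i)"
    have coeff: "coeff p k = (if k \<in> I then of_rat (u (x ^ k)) else 0)" for k
      using I(1) by (simp add: p_def coeff_sum)
    show ?thesis
    proof (rule algebraicI')
      show "coeff p k \<in> \<rat>" for k by (simp add: coeff)
      show "p \<noteq> 0" using T(4) I(2) by (auto simp: poly_eq_iff coeff)
      have "inj_on ((^) x) I" using True by (rule inj_on_subset) simp
      then show "poly p x = 0"
        using T(3) I(2) by (simp add: p_def poly_sum poly_monom sum.reindex o_def)
    qed
  qed
qed

text \<open>A rational subalgebra is a rational subspace, so one that contains a basis is the whole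
  field.\<close>

lemma number_field_additive:
  assumes nf: "number_field TYPE('a::field_char_0)"
    and add: "\<And>x y :: 'a. \<phi> (x + y) = \<phi> x + \<phi> y"
  shows "hom_combination UNIV \<phi>"
proof -
  obtain B where "finite_dimensional_vector_space (\<lambda>(q::rat) (x::'a). of_rat q * x) B"
    using nf by (auto simp: number_field_def)
  then interpret V: finite_dimensional_vector_space "\<lambda>(q::rat) (x::'a). of_rat q * x" B .
  obtain F where F: "rational_subalgebra F" "B \<subseteq> F" "spanned_by_homs F"
    using spanned_by_homs_superset[OF number_field_algebraic[OF nf] V.finite_Basis] by blast
  have "V.span B \<subseteq> F"
  proof (rule V.span_minimal[OF F(2)])
    show "V.subspace F"
      using subalgebra_Rats[OF F(1)] by (intro V.subspaceI)
        (auto simp: subalgebra_0[OF F(1)] intro: subalgebra_add[OF F(1)] subalgebra_mult[OF F(1)])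
  qed
  then have "F = UNIV" using V.span_Basis by auto
  then show ?thesis using F(3) add by (simp add: spanned_by_homs_def additive_on_def)
qed

section \<open>Clearing denominators\<close>

text \<open>If \<open>p\<close> has degree \<open>n\<close> and leading coefficient
  \<open>c\<close>, then \<open>c ^ (n - 1) * p(X / c)\<close> is monic with integer coefficients
  and has the root \<open>c * x\<close>.\<close>

lemma algebraic_integral_multiple:
  assumes "algebraic (x :: 'a::field_char_0)"
  shows "\<exists>c :: int. c \<noteq> 0 \<and> algebraic_int (of_int c * x)"
proof -
  obtain p :: "int poly" where p: "p \<noteq> 0" "poly (map_poly of_int p) x = 0"
    using algebraicE'[OF assms] by blast
  define n where "n = degree p"
  define c where "c = lead_coeff p"
  have c: "c \<noteq> 0" using p by (simp add: c_def)
  have root: "(\<Sum>i\<le>n. of_int (coeff p i) * x ^ i) = 0"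
    using p(2) by (simp add: poly_altdef degree_map_poly coeff_map_poly n_def)
  have "n \<noteq> 0"
  proof
    assume "n = 0"
    then show False using root c by (simp add: n_def c_def)
  qed
  then obtain m where m: "n = Suc m" by (cases n) auto
  define a :: "nat \<Rightarrow> 'a" where "a i = (if i = n then 1 else of_int (coeff p i * c ^ (m - i)))" for i
  define q where "q = (\<Sum>i\<le>n. monom (a i) i)"
  have coeff_q: "coeff q i = (if i \<le> n then a i else 0)" for i
    by (auto simp: q_def coeff_sum)
  have "algebraic_int (of_int c * x)"
  proof (rule algebraic_int.intros)
    have "degree q = n"
      by (rule antisym[OF degree_le le_degree]) (auto simp: coeff_q a_def)
    then show "lead_coeff q = 1" by (simp add: coeff_q a_def)
    show "\<forall>i. coeff q i \<in> \<int>" by (simp add: coeff_q a_def)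
    have "a i * (of_int c * x) ^ i = of_int c ^ m * (of_int (coeff p i) * x ^ i)" if "i \<le> n" for i
    proof (cases "i = n")
      case True
      then show ?thesis by (simp add: a_def m c_def n_def[symmetric] power_mult_distrib)
    next
      case False
      then have "m = (m - i) + i" using that m by simp
      then have "of_int c ^ m = (of_int c ^ (m - i) * of_int c ^ i :: 'a)" by (metis power_add)
      then show ?thesis using False by (simp add: a_def power_mult_distrib)
    qed
    then have "poly q (of_int c * x) = (\<Sum>i\<le>n. of_int c ^ m * (of_int (coeff p i) * x ^ i))"
      by (simp add: q_def poly_sum poly_monom)
    also have "\<dots> = 0" by (simp only: sum_distrib_left[symmetric] root) simp
    finally show "poly q (of_int c * x) = 0" .
  qed
  then show ?thesis using c by blast
qed

lemma common_denominator:
  fixes u :: "'b \<Rightarrow> rat"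
  assumes "finite T"
  shows "\<exists>D :: int. D \<noteq> 0 \<and> (\<forall>v\<in>T. of_int D * u v \<in> \<int>)"
  using assms
proof (induction rule: finite_induct)
  case empty
  show ?case by (rule exI[of _ 1]) simp
next
  case (insert v T)
  then obtain D :: int where D: "D \<noteq> 0" "\<forall>v\<in>T. of_int D * u v \<in> \<int>" by blast
  obtain a b :: int where ab: "u v = of_int a / of_int b" "b > 0"
    by (metis Fract_of_int_quotient Rat_cases)
  have "of_int (D * b) * u v = of_int (D * a)" using ab by simp
  then have "of_int (D * b) * u v \<in> \<int>" by (simp only: Ints_of_int)
  moreover have "of_int (D * b) * u w \<in> \<int>" if "w \<in> T" for w
  proof -
    have "of_int (D * b) * u w = of_int b * (of_int D * u w)" by simp
    then show ?thesis using D(2) that by (simp only: Ints_mult Ints_of_int)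
  qed
  moreover have "D * b \<noteq> 0" using D(1) ab(2) by simp
  ultimately show ?case by (intro exI[of _ "D * b"] conjI ballI) (auto simp only: insert_iff)
qed

subsection \<open>Simultaneous approximation of powers\<close>

lemma Dirichlet_approx_finite:
  fixes \<theta> :: "'i \<Rightarrow> real"
  assumes "finite I" "0 < N"
  shows "\<exists>q p. 0 < q \<and> (\<forall>i\<in>I. \<bar>of_int q * \<theta> i - of_int (p i)\<bar> < 1 / real N)"
proof -
  obtain h where h: "bij_betw h {0..<card I} I"
    using ex_bij_betw_nat_finite[OF assms(1)] by blast
  obtain q p where q: "0 < q" and p: "\<And>k. k < card I \<Longrightarrow> \<bar>of_int q * \<theta> (h k) - of_int (p k)\<bar> < 1 / real N"
    using Dirichlet_approx_simult[OF assms(2), where n = "card I" and \<theta> = "\<lambda>k. \<theta> (h k)"] by metis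
  have "\<bar>of_int q * \<theta> i - of_int (p (inv_into {0..<card I} h i))\<bar> < 1 / real N" if "i \<in> I" for i
    using p[of "inv_into {0..<card I} h i"] bij_betw_inv_into_right[OF h that]
      bij_betwE[OF bij_betw_inv_into[OF h]] that by auto
  then show ?thesis using q by (intro exI[of _ q] exI[of _ "\<lambda>i. p (inv_into {0..<card I} h i)"]) simp
qed

text \<open>
  The one-parameter group \<open>s \<mapsto> s / ln (r j)\<close>, \<open>s \<mapsto> s * Arg (\<beta> j \<sigma>) / (2 * pi * ln (r j))\<close> on a torus
  returns near the identity; at a return time \<open>s\<close>, each \<open>\<beta> j \<sigma>\<close> has a power close to \<open>exp s\<close>.
\<close>

lemma simultaneous_powers:
  fixes \<beta> :: "'j \<Rightarrow> 's \<Rightarrow> complex" and r :: "'j \<Rightarrow> real"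
  assumes fin: "finite J" "finite E"
    and norm: "\<And>j \<sigma>. j \<in> J \<Longrightarrow> \<sigma> \<in> E \<Longrightarrow> norm (\<beta> j \<sigma>) = r j"
    and r: "\<And>j. j \<in> J \<Longrightarrow> 1 < r j"
    and "0 < \<eta>"
  shows "\<exists>n. (\<forall>j\<in>J. n0 \<le> n j) \<and>
    (\<forall>i\<in>J. \<forall>j\<in>J. \<forall>\<sigma>\<in>E. norm (\<beta> i \<sigma> ^ n i / \<beta> j \<sigma> ^ n j - 1) \<le> \<eta>)"
proof -
  have "isCont exp (0 :: complex)" by simp
  then have "\<exists>\<delta>>0. \<forall>w :: complex. dist w 0 < \<delta> \<longrightarrow> dist (exp w) (exp 0) < \<eta>"
    using \<open>0 < \<eta>\<close> unfolding continuous_at_eps_delta by blast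
  then obtain \<delta> where \<delta>: "0 < \<delta>" "\<And>w :: complex. norm w < \<delta> \<Longrightarrow> norm (exp w - 1) < \<eta>"
    by (auto simp: dist_norm)
  \<comment> \<open>A logarithm of \<open>\<beta> j \<sigma>\<close>.\<close>
  define L where "L j \<sigma> = Complex (ln (r j)) (Arg (\<beta> j \<sigma>))" for j \<sigma>
  define K where "K = (\<Sum>j\<in>J. \<Sum>\<sigma>\<in>E. norm (L j \<sigma>)) + 2 * pi"
  have K: "norm (L j \<sigma>) + 2 * pi \<le> K" if "j \<in> J" "\<sigma> \<in> E" for j \<sigma>
  proof -
    have "norm (L j \<sigma>) \<le> (\<Sum>\<sigma>\<in>E. norm (L j \<sigma>))"
      using that fin by (intro member_le_sum) auto
    also have "\<dots> \<le> (\<Sum>j\<in>J. \<Sum>\<sigma>\<in>E. norm (L j \<sigma>))"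
      using that fin by (intro member_le_sum[of j J "\<lambda>j. \<Sum>\<sigma>\<in>E. norm (L j \<sigma>)"]) (auto intro: sum_nonneg)
    finally show ?thesis by (simp add: K_def)
  qed
  have "0 < K" unfolding K_def by (intro add_nonneg_pos sum_nonneg) auto
  \<comment> \<open>Approximation errors below \<open>1 / N\<close> disturb each logarithm by at
    most \<open>K / N\<close>, hence a difference of two by less than \<delta>.\<close>
  obtain N :: nat where N: "2 * K / \<delta> < real N" using reals_Archimedean2 by blast
  have "0 < 2 * K / \<delta>" using \<open>0 < K\<close> \<delta>(1) by simp
  then have "0 < real N" using N by linarith
  then have "0 < N" by simp
  \<comment> \<open>Large enough that each \<open>a j\<close> is at least \<open>n0 + 1\<close>;
    rounding a positive integer multiple of it then leaves an exponent of at least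
    \<open>n0\<close>.\<close>
  define \<tau> where "\<tau> = (real n0 + 1) * (\<Sum>j\<in>J. ln (r j))"
  define a where "a j = \<tau> / ln (r j)" for j
  have ln_pos: "0 < ln (r j)" if "j \<in> J" for j using r[OF that] by simp
  have a_ge: "real n0 + 1 \<le> a j" if "j \<in> J" for j
  proof -
    have "ln (r j) \<le> (\<Sum>j\<in>J. ln (r j))"
      using that fin ln_pos by (intro member_le_sum) (auto intro: less_imp_le)
    then have "(real n0 + 1) * ln (r j) \<le> \<tau>" unfolding \<tau>_def by (intro mult_left_mono) auto
    then show ?thesis using ln_pos[OF that] by (simp add: a_def le_divide_eq)
  qed
  \<comment> \<open>Index \<open>None\<close> asks for a nearly integral exponent, index
    \<open>Some \<sigma>\<close> for a nearly integral number of turns of the argument.\<close>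
  define \<theta> where "\<theta> = (\<lambda>(j, s). case s of None \<Rightarrow> a j | Some \<sigma> \<Rightarrow> a j * (Arg (\<beta> j \<sigma>) / (2 * pi)))"
  have "finite (J \<times> insert None (Some ` E))" using fin by simp
  from Dirichlet_approx_finite[OF this \<open>0 < N\<close>, of \<theta>] obtain q p where q: "0 < q"
    and p: "\<And>i. i \<in> J \<times> insert None (Some ` E) \<Longrightarrow> \<bar>of_int q * \<theta> i - of_int (p i)\<bar> < 1 / real N"
    by auto
  define e where "e j = of_int q * a j - of_int (p (j, None))" for j
  define e' where "e' j \<sigma> = of_int q * (a j * (Arg (\<beta> j \<sigma>) / (2 * pi))) - of_int (p (j, Some \<sigma>))" for j \<sigma>
  have e: "\<bar>e j\<bar> < 1 / real N" if "j \<in> J" for j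
    using p[of "(j, None)"] that by (simp add: e_def \<theta>_def)
  have e': "\<bar>e' j \<sigma>\<bar> < 1 / real N" if "j \<in> J" "\<sigma> \<in> E" for j \<sigma>
    using p[of "(j, Some \<sigma>)"] that by (simp add: e'_def \<theta>_def)
  define n where "n j = nat (p (j, None))" for j
  have p_ge: "int n0 \<le> p (j, None)" if "j \<in> J" for j
  proof -
    have "1 * (real n0 + 1) \<le> of_int q * a j"
      using q a_ge[OF that] by (intro mult_mono) auto
    moreover have "1 / real N \<le> 1" using \<open>0 < N\<close> by simp
    ultimately have "real n0 < of_int (p (j, None))"
      using e[OF that] unfolding e_def mult_1 by linarith
    then show ?thesis by linarith
  qed
  \<comment> \<open>The error in the logarithm: \<open>n j * L j \<sigma>\<close> is the common real
    number \<open>q * \<tau>\<close> plus \<open>u j \<sigma>\<close> plus an integer multiple of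
    \<open>2 * pi * \<i>\<close>. The common part cancels in quotients.\<close>
  define u where "u j \<sigma> = - of_real (e j) * L j \<sigma> + 2 * of_real pi * of_real (e' j \<sigma>) * \<i>" for j \<sigma>
  have pow: "\<beta> j \<sigma> ^ n j = exp (of_real (of_int q * \<tau>)) * exp (u j \<sigma>)" if j: "j \<in> J" "\<sigma> \<in> E" for j \<sigma>
  proof -
    have nz: "\<beta> j \<sigma> \<noteq> 0" using norm[OF j] r[OF j(1)] by auto
    have "exp (L j \<sigma>) = \<beta> j \<sigma>"
      using norm[OF j] r[OF j(1)] Arg_eq[OF nz]
      by (simp add: L_def Complex_eq exp_add exp_of_real mult.commute)
    then have "\<beta> j \<sigma> ^ n j = exp (of_nat (n j) * L j \<sigma>)" by (simp add: exp_of_nat_mult)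
    also have "of_nat (n j) * L j \<sigma> = of_real (of_int q * a j - e j) * L j \<sigma>"
      using p_ge[OF j(1)] by (simp add: n_def e_def)
    also have "\<dots> = of_real (of_int q * \<tau>) + u j \<sigma> + 2 * of_int (p (j, Some \<sigma>)) * of_real pi * \<i>"
      using ln_pos[OF j(1)]
      by (auto simp: complex_eq_iff L_def u_def e'_def a_def field_simps)
    also have "exp \<dots> = exp (of_real (of_int q * \<tau>)) * exp (u j \<sigma>)"
      using exp_integer_2pi[OF Ints_of_int, of "p (j, Some \<sigma>)"] by (simp add: exp_add)
    finally show ?thesis .
  qed
  have u: "norm (u j \<sigma>) \<le> K / real N" if j: "j \<in> J" "\<sigma> \<in> E" for j \<sigma>
  proof -
    have "norm (u j \<sigma>) \<le> \<bar>e j\<bar> * norm (L j \<sigma>) + \<bar>e' j \<sigma>\<bar> * (2 * pi)"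
      unfolding u_def by (rule norm_triangle_le) (simp add: norm_mult)
    also have "\<dots> \<le> 1 / real N * norm (L j \<sigma>) + 1 / real N * (2 * pi)"
      using e[OF j(1)] e'[OF j] by (intro add_mono mult_right_mono) auto
    also have "\<dots> = 1 / real N * (norm (L j \<sigma>) + 2 * pi)" by (simp add: distrib_left)
    also have "\<dots> \<le> 1 / real N * K" using K[OF j] by (intro mult_left_mono) auto
    finally show ?thesis by simp
  qed
  have "norm (\<beta> i \<sigma> ^ n i / \<beta> j \<sigma> ^ n j - 1) \<le> \<eta>" if ij: "i \<in> J" "j \<in> J" "\<sigma> \<in> E" for i j \<sigma>
  proof -
    have "\<beta> i \<sigma> ^ n i / \<beta> j \<sigma> ^ n j = exp (u i \<sigma> - u j \<sigma>)"
      using pow[OF ij(1,3)] pow[OF ij(2,3)] by (simp add: exp_diff)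
    have "norm (u i \<sigma> - u j \<sigma>) \<le> 2 * K / real N"
      using norm_triangle_ineq4[of "u i \<sigma>" "u j \<sigma>"] u[OF ij(1,3)] u[OF ij(2,3)] by simp
    moreover have "2 * K / real N < \<delta>"
      using N \<delta>(1) \<open>0 < real N\<close> by (simp add: divide_less_eq mult.commute)
    ultimately have "norm (u i \<sigma> - u j \<sigma>) < \<delta>" by linarith
    then show ?thesis using \<delta>(2) \<open>\<beta> i \<sigma> ^ n i / \<beta> j \<sigma> ^ n j = _\<close> by (simp add: less_imp_le)
  qed
  moreover have "n0 \<le> n j" if "j \<in> J" for j using p_ge[OF that] by (simp add: n_def)
  ultimately show ?thesis by blast
qed

subsection \<open>Digits and holes\<close>

text \<open>An abstract form of a number field with an integral basis. \<open>S\<close> bounds the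
  norm on coordinate vectors with entries at most 1 in absolute value, and \<open>C\<close> bounds
  coordinates by the norm.\<close>

locale lattice_norm =
  fixes \<Omega> :: "'a::field_char_0 set" and coord :: "'a \<Rightarrow> 'a \<Rightarrow> rat" and N :: "'a \<Rightarrow> real" and C S :: real
  assumes finite_basis: "finite \<Omega>"
    and sum_coord: "(\<Sum>w\<in>\<Omega>. of_rat (coord x w) * w) = x"
    and coord_sum: "w \<in> \<Omega> \<Longrightarrow> coord (\<Sum>v\<in>\<Omega>. of_rat (u v) * v) w = u w"
    and N_triangle: "N (x + y) \<le> N x + N y"
    and N_minus: "N (- x) = N x"
    and N_of_rat: "N (of_rat q) = \<bar>of_rat q\<bar>"
    and N_sum_le: "(\<And>w. w \<in> \<Omega> \<Longrightarrow> \<bar>u w\<bar> \<le> 1) \<Longrightarrow> N (\<Sum>w\<in>\<Omega>. of_rat (u w) * w) \<le> S"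
    and coord_le: "w \<in> \<Omega> \<Longrightarrow> \<bar>of_rat (coord x w)\<bar> \<le> C * N x"
    and C_ge_1: "1 \<le> C"
    and S_ge_1: "1 \<le> S"
begin

definition lattice :: "'a set" where
  "lattice = {x. \<forall>w\<in>\<Omega>. coord x w \<in> \<int>}"

definition flr :: "'a \<Rightarrow> 'a" where
  "flr x = (\<Sum>w\<in>\<Omega>. of_rat (of_int \<lfloor>coord x w\<rfloor>) * w)"

text \<open>What is left of \<open>z\<close> after its lowest \<open>l\<close> digits have been
  split off.\<close>

primrec quot :: "'a \<Rightarrow> 'a \<Rightarrow> nat \<Rightarrow> 'a" where
  "quot b z 0 = z"
| "quot b z (Suc l) = flr (quot b z l / b)"

text \<open>For nonzero \<open>b\<close> this is \<open>b\<close> times the coordinatewise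
  fractional part of \<open>quot b z l / b\<close>, which places it in the half-open
  parallelepiped.\<close>

definition digit :: "'a \<Rightarrow> 'a \<Rightarrow> nat \<Rightarrow> 'a" where
  "digit b z l = quot b z l - b * quot b z (Suc l)"

definition similarity :: "'a \<Rightarrow> real \<Rightarrow> bool" where
  "similarity b r \<longleftrightarrow> (\<forall>x. N (b * x) = r * N x)"

lemma coord_add: "w \<in> \<Omega> \<Longrightarrow> coord (x + y) w = coord x w + coord y w"
proof -
  assume w: "w \<in> \<Omega>"
  have "x + y = (\<Sum>w\<in>\<Omega>. of_rat (coord x w + coord y w) * w)"
    by (simp add: of_rat_add distrib_right sum.distrib sum_coord)
  then show ?thesis using coord_sum[OF w, of "\<lambda>w. coord x w + coord y w"] by simp
qed

lemma coord_minus: "w \<in> \<Omega> \<Longrightarrow> coord (- x) w = - coord x w"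
proof -
  assume w: "w \<in> \<Omega>"
  have "- x = (\<Sum>w\<in>\<Omega>. of_rat (- coord x w) * w)"
    by (simp add: of_rat_minus sum_negf sum_coord)
  then show ?thesis using coord_sum[OF w, of "\<lambda>w. - coord x w"] by simp
qed

lemma coord_diff: "w \<in> \<Omega> \<Longrightarrow> coord (x - y) w = coord x w - coord y w"
  using coord_add[of w x "- y"] coord_minus[of w y] by simp

lemma coord_flr: "w \<in> \<Omega> \<Longrightarrow> coord (flr x) w = of_int \<lfloor>coord x w\<rfloor>"
  unfolding flr_def by (rule coord_sum)

lemma coord_eqI: "(\<And>w. w \<in> \<Omega> \<Longrightarrow> coord x w = coord y w) \<Longrightarrow> x = y"
  by (subst sum_coord[of x, symmetric], subst sum_coord[of y, symmetric]) simp

lemma coord_0: "w \<in> \<Omega> \<Longrightarrow> coord 0 w = 0"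
  using coord_diff[of w 0 0] by simp

lemma flr_in_lattice: "flr x \<in> lattice"
  by (simp add: lattice_def coord_flr)

lemma lattice_diff: "x \<in> lattice \<Longrightarrow> y \<in> lattice \<Longrightarrow> x - y \<in> lattice"
  by (simp add: lattice_def coord_diff)

lemma N_0: "N 0 = 0"
  using N_of_rat[of 0] by simp

lemma N_nonneg: "0 \<le> N x"
  using N_triangle[of x "- x"] by (simp add: N_minus N_0)

lemma N_diff_commute: "N (x - y) = N (y - x)"
  using N_minus[of "x - y"] by simp

lemma N_triangle_diff: "N (x - z) \<le> N (x - y) + N (y - z)"
  using N_triangle[of "x - y" "y - z"] by simp

lemma N_frac_le: "N (x - flr x) \<le> S"
proof -
  have "x - flr x = (\<Sum>w\<in>\<Omega>. of_rat (frac (coord x w)) * w)"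
    by (rule coord_eqI) (simp only: coord_diff coord_flr coord_sum frac_def)
  moreover have "\<bar>frac (q::rat)\<bar> \<le> 1" for q
    using frac_lt_1[of q] frac_ge_0[of q] unfolding abs_le_iff
    by (metis less_imp_le neg_le_0_iff_le order_trans zero_le_one)
  ultimately show ?thesis using N_sum_le[of "\<lambda>w. frac (coord x w)"] by metis
qed

text \<open>Some coordinate is a nonzero integer, and coordinates are bounded by the norm.\<close>

lemma N_lattice_ge:
  assumes "y \<in> lattice" "y \<noteq> 0"
  shows "1 / C \<le> N y"
proof -
  obtain w where w: "w \<in> \<Omega>" "coord y w \<noteq> 0"
    using assms(2) coord_eqI[of y 0] coord_0 by auto
  obtain i :: int where i: "coord y w = of_int i"
    using assms(1) w by (auto simp: lattice_def elim: Ints_cases)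
  have "i \<noteq> 0" using i w(2) by auto
  then have "1 \<le> \<bar>of_int i :: real\<bar>" by linarith
  also have "\<dots> \<le> C * N y"
    using coord_le[OF w(1), of y] unfolding i by (simp only: of_rat_of_int_eq)
  finally show ?thesis using C_ge_1 by (simp add: field_simps)
qed

lemma similarityD: "similarity b r \<Longrightarrow> N (b * x) = r * N x"
  by (simp add: similarity_def)

lemma similarity_power: "similarity b r \<Longrightarrow> N (b ^ l * x) = r ^ l * N x"
  by (induction l arbitrary: x) (simp_all add: similarityD mult.assoc)

lemma similarity_nonzero: "similarity b r \<Longrightarrow> 0 < r \<Longrightarrow> b \<noteq> 0"
  using similarityD[of b r 1] N_of_rat[of 1] by (auto simp: N_0)

lemma N_digit_le:
  assumes "similarity b r" "0 < r"
  shows "N (digit b z l) \<le> r * S"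
proof -
  have "digit b z l = b * (quot b z l / b - flr (quot b z l / b))"
    using similarity_nonzero[OF assms] by (simp add: digit_def field_simps)
  then show ?thesis using similarityD[OF assms(1)] N_frac_le assms(2) by simp
qed

lemma quot_Suc_eq: "z - b ^ Suc l * quot b z (Suc l) = (z - b ^ l * quot b z l) + b ^ l * digit b z l"
  by (simp add: digit_def algebra_simps)

lemma expansion: "(\<Sum>l<n. digit b z l * b ^ l) = z - b ^ n * quot b z n"
  by (induction n) (simp_all only: sum.lessThan_Suc quot_Suc_eq, simp_all add: mult.commute)

text \<open>The digits contribute a geometric sum with terms \<open>S * r ^ (i + 1)\<close>; for
  \<open>r \<ge> 2\<close> it is at most twice its last term.\<close>

lemma N_lower_digits_le:
  assumes "similarity b r" "2 \<le> r"
  shows "N (z - b ^ l * quot b z l) \<le> 2 * S * r ^ l"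
proof (induction l)
  case (Suc l)
  have "N (z - b ^ Suc l * quot b z (Suc l)) \<le> N (z - b ^ l * quot b z l) + N (b ^ l * digit b z l)"
    unfolding quot_Suc_eq by (rule N_triangle)
  also have "N (b ^ l * digit b z l) \<le> r ^ l * (r * S)"
    using similarity_power[OF assms(1)] N_digit_le[OF assms(1)] assms(2) by (simp add: mult_left_mono)
  also have "N (z - b ^ l * quot b z l) \<le> r * (S * r ^ l)"
  proof -
    have "2 * (S * r ^ l) \<le> r * (S * r ^ l)"
      using S_ge_1 assms(2) by (intro mult_right_mono) auto
    then show ?thesis using Suc.IH by (simp add: mult.assoc)
  qed
  finally show ?case by (simp add: algebra_simps)
qed (use S_ge_1 in \<open>simp add: N_0\<close>)

text \<open>With \<open>y\<close> the next quotient, \<open>quot b z l = d + b * y\<close>, so only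
  the lower digits separate \<open>z\<close> from the centre of a hole.\<close>

lemma digit_eq_imp_near:
  assumes "similarity b r" "2 \<le> r" "digit b z l = d"
  shows "\<exists>y\<in>lattice. N (z - b ^ l * (d + b * y)) \<le> 2 * S * r ^ l"
proof (rule bexI)
  have "d + b * quot b z (Suc l) = quot b z l"
    using assms(3) unfolding digit_def by (metis diff_add_cancel)
  then show "N (z - b ^ l * (d + b * quot b z (Suc l))) \<le> 2 * S * r ^ l"
    using N_lower_digits_le[OF assms(1,2)] by metis
qed (simp add: flr_in_lattice)

lemma holes_separated:
  assumes "similarity b r" "0 < r" "y \<in> lattice" "y' \<in> lattice" "y \<noteq> y'"
  shows "r ^ Suc l / C \<le> N (b ^ l * (d + b * y) - b ^ l * (d + b * y'))"
proof -
  have "b ^ l * (d + b * y) - b ^ l * (d + b * y') = b ^ Suc l * (y - y')"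
    by (simp add: algebra_simps)
  then have "N (b ^ l * (d + b * y) - b ^ l * (d + b * y')) = r ^ Suc l * N (y - y')"
    using similarity_power[OF assms(1)] by metis
  moreover have "1 / C \<le> N (y - y')"
    using assms by (intro N_lattice_ge lattice_diff) auto
  then have "r ^ Suc l * (1 / C) \<le> r ^ Suc l * N (y - y')"
    using assms(2) by (intro mult_left_mono) auto
  ultimately show ?thesis by simp
qed

text \<open>The hypothesis places \<open>z / b ^ n\<close> well inside the unit cube. The lower
  \<open>n - 1\<close> digits contribute less than 1/4 to each of its coordinates; without them,
  what remains still lies in the cube and has floor 0.\<close>

lemma quot_eq_0:
  assumes sim: "similarity b r" and r: "2 \<le> r" "16 * S * C < r" and n: "n \<ge> 1"
    and z: "\<And>w. w \<in> \<Omega> \<Longrightarrow> \<bar>coord (z / b ^ n) w - 1/2\<bar> \<le> 1/4"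
  shows "quot b z n = 0"
proof (rule coord_eqI)
  fix w assume w: "w \<in> \<Omega>"
  obtain m where m: "n = Suc m" using n by (cases n) auto
  have b: "b \<noteq> 0" using similarity_nonzero[OF sim] r by simp
  define f where "f = quot b z m / b"
  define e where "e = (z - b ^ m * quot b z m) / b ^ n"
  have eq: "z / b ^ n = e + f"
    using b by (simp add: e_def f_def m field_simps)
  have "b ^ n * e = z - b ^ m * quot b z m" using b by (simp add: e_def)
  then have "r ^ n * N e \<le> 2 * S * r ^ m"
    using N_lower_digits_le[OF sim r(1), of z m] similarity_power[OF sim, of n e] by simp
  then have "r * N e \<le> 2 * S" using r by (simp add: m)
  have "C * N e * r = C * (r * N e)" by simp
  also have "\<dots> \<le> C * (2 * S)" using \<open>r * N e \<le> 2 * S\<close> C_ge_1 by (intro mult_left_mono) auto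
  also have "\<dots> < 1/4 * r" using r by (simp add: mult.commute)
  finally have "C * N e < 1/4" using r by (simp only: mult_less_cancel_right)
  then have "\<bar>of_rat (coord e w) :: real\<bar> < of_rat (1/4)"
    using coord_le[OF w, of e] by (simp add: of_rat_divide)
  then have e: "\<bar>coord e w\<bar> < 1/4"
    by (metis of_rat_less abs_of_rat)
  have q: "coord (quot b z n) w = of_int \<lfloor>coord f w\<rfloor>"
    by (simp add: m f_def coord_flr[OF w])
  have "coord e w + coord f w = coord (z / b ^ n) w" using eq coord_add[OF w] by simp
  then have "0 \<le> coord f w" "coord f w < 1"
    using z[OF w] e by linarith+
  then have "\<lfloor>coord f w\<rfloor> = 0" by linarith
  then show "coord (quot b z n) w = coord 0 w" using q coord_0[OF w] by simp
qed

end

section \<open>A game of shrinking balls against holes\<close>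

text \<open>One round divides the radius by \<open>T\<close>, and \<epsilon> tells large from small
  holes relative to the radius. Both are tuned to \<open>card J + 1\<close> candidates per round;
  \<open>r_large\<close> keeps two holes of the same base and level too far apart to interfere
  within one ball.\<close>

locale digit_game = lattice_norm \<Omega> coord N C S
  for \<Omega> :: "'a::field_char_0 set" and coord :: "'a \<Rightarrow> 'a \<Rightarrow> rat" and N :: "'a \<Rightarrow> real" and C S :: real +
  fixes J :: "'i set" and b d :: "'i \<Rightarrow> 'a" and r :: "'i \<Rightarrow> real" and n :: "'i \<Rightarrow> nat" and T \<epsilon> :: real
  assumes finite_J: "finite J"
    and sim: "j \<in> J \<Longrightarrow> similarity (b j) (r j)"
    and T_def: "T = 16 * (real (card J) + 1)"
    and \<epsilon>_def: "\<epsilon> = 1 / (32 * S * (real (card J) + 1))"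
    and r_large: "j \<in> J \<Longrightarrow> 2 * (T * C / \<epsilon>) < r j"
begin

definition hole :: "'i \<Rightarrow> nat \<Rightarrow> 'a \<Rightarrow> 'a" where
  "hole j l y = b j ^ l * (d j + b j * y)"

text \<open>The invariant of the game: the ball of radius \<open>R\<close> about \<open>x\<close>
  misses every hole of scale at least \<open>\<epsilon> * R\<close>, while smaller holes are left to
  later rounds. The hole radius \<open>2 * S * r j ^ l\<close> is the bound for the lower
  digits.\<close>

definition clear :: "'a \<Rightarrow> real \<Rightarrow> bool" where
  "clear x R \<longleftrightarrow> (\<forall>j\<in>J. \<forall>l<n j. \<forall>y\<in>lattice. \<epsilon> * R \<le> r j ^ l \<longrightarrow>
     R + 2 * S * r j ^ l < N (x - hole j l y))"

text \<open>\<open>S_le\<close> leaves room for rounding to the lattice at the end.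
  \<open>T_\<epsilon>_eq\<close> bounds, relative to the radius, how far apart two candidates
  obstructed by one hole can be.\<close>

lemma T_ge: "16 \<le> T" and \<epsilon>_pos: "0 < \<epsilon>" and \<epsilon>_le_1: "\<epsilon> \<le> 1"
  and S_le: "S \<le> 1 / (\<epsilon> * T)"
  and T_\<epsilon>_eq: "2 / T + 4 * S * \<epsilon> = 1 / (4 * (real (card J) + 1))"
proof -
  show "16 \<le> T" by (simp add: T_def)
  show "0 < \<epsilon>" using S_ge_1 by (simp add: \<epsilon>_def)
  have "1 * 1 \<le> (32 * S) * (real (card J) + 1)"
    using S_ge_1 by (intro mult_mono) auto
  then show "\<epsilon> \<le> 1" by (simp add: \<epsilon>_def divide_le_eq_1)
  have "\<epsilon> * T = 1 / (2 * S)"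
    using S_ge_1 by (simp add: \<epsilon>_def T_def divide_simps)
  then show "S \<le> 1 / (\<epsilon> * T)"
    using S_ge_1 by simp
  have sum: "1 / (8 * c) + 4 / (32 * c) = 1 / (4 * c)" if "0 < c" for c :: real
    using that by (simp add: field_simps)
  have "2 / T = 1 / (8 * (real (card J) + 1))" by (simp add: T_def divide_simps)
  moreover have "S * \<epsilon> = 1 / (32 * (real (card J) + 1))"
    using S_ge_1 by (simp add: \<epsilon>_def)
  then have "4 * S * \<epsilon> = 4 / (32 * (real (card J) + 1))" by simp
  ultimately show "2 / T + 4 * S * \<epsilon> = 1 / (4 * (real (card J) + 1))"
    using sum[of "real (card J) + 1"] by (simp only: sum add_nonneg_pos of_nat_0_le_iff zero_less_one)
qed

text \<open>Hence the powers of \<open>r j\<close> grow at least as fast as the radius shrinks, and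
  a round meets at most one level of each base.\<close>

lemma r_ge_T:
  assumes "j \<in> J"
  shows "T \<le> r j"
proof -
  define X where "X = T * C / \<epsilon>"
  have "T * 1 \<le> T * (C / \<epsilon>)"
    using C_ge_1 \<epsilon>_le_1 \<epsilon>_pos T_ge by (intro mult_left_mono) (auto simp: le_divide_eq)
  then have "T \<le> X" by (simp add: X_def)
  moreover have "2 * X < r j" using r_large[OF assms] by (simp only: X_def)
  ultimately show ?thesis using T_ge by linarith
qed

text \<open>
  Among \<open>card J + 1\<close> equidistant points, two would fail because of the same base, by the pigeonhole
  principle; sizes and distances force the two obstructing holes to be the same, and a single
  hole is too small to affect both points.
\<close>

lemma clear_step:
  assumes "clear x R" "0 < R"
  shows "\<exists>x'. N (x' - x) \<le> R - R / T \<and> clear x' (R / T)"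
proof (rule ccontr)
  assume contra: "\<not> ?thesis"
  define k where "k = card J"
  have "R / (4 * (real k + 1)) < R / (2 * (real k + 1))"
    using assms(2) by (intro divide_strict_left_mono) auto
  \<comment> \<open>A rational spacing gives exact distances by \<open>N_of_rat\<close>. The upper
    bound keeps the \<open>k + 1\<close> candidates within \<open>R / 2\<close> of \<open>x\<close>;
    the lower bound is at least the reach of a single hole.\<close>
  then obtain q where q: "R / (4 * (real k + 1)) < of_rat q" "of_rat q < R / (2 * (real k + 1))"
    using of_rat_dense by blast
  define cand where "cand i = x + of_rat (of_nat i * q)" for i :: nat
  have q_pos: "0 < (of_rat q :: real)"
    using q(1) assms(2) by (smt (verit) divide_nonneg_nonneg of_nat_0_le_iff)
  have dist: "N (cand i - cand i') = \<bar>real i - real i'\<bar> * of_rat q" for i i'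
  proof -
    have "cand i - cand i' = of_rat ((of_nat i - of_nat i') * q)"
      by (simp add: cand_def of_rat_diff of_rat_mult algebra_simps)
    then have "N (cand i - cand i') = \<bar>of_rat ((of_nat i - of_nat i') * q)\<bar>" by (simp only: N_of_rat)
    then show ?thesis using q_pos by (simp add: of_rat_mult of_rat_diff abs_mult)
  qed
  have near: "N (cand i - x) \<le> R / 2" if "i \<le> k" for i
  proof -
    have "N (cand i - cand 0) \<le> real k * of_rat q"
      using that q_pos by (simp add: dist mult_right_mono)
    also have "\<dots> \<le> (real k + 1) * (R / (2 * (real k + 1)))"
      using q(2) q_pos by (intro mult_mono) auto
    also have "\<dots> = R / 2"
      by (metis (no_types, opaque_lifting) add.commute mult.commute mult_numeral_1_right nonzero_mult_divide_mult_cancel_left of_nat_Suc of_nat_neq_0 times_divide_eq_right)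
    finally show ?thesis by (simp add: cand_def)
  qed
  have RT: "R / T \<le> R / 16" using T_ge assms(2) by (intro divide_left_mono) auto
  \<comment> \<open>The ball of radius \<open>R\<close> already avoids the larger holes, so a
    candidate can only fail because of a scale between \<open>\<epsilon> * R / T\<close> and
    \<open>\<epsilon> * R\<close>.\<close>
  have "\<exists>j l y. j \<in> J \<and> y \<in> lattice \<and> \<epsilon> * R / T \<le> r j ^ l \<and> r j ^ l < \<epsilon> * R \<and>
      N (cand i - hole j l y) \<le> R / T + 2 * S * r j ^ l" if i: "i \<le> k" for i
  proof -
    have "N (cand i - x) \<le> R - R / T" using near[OF i] RT assms(2) by simp
    then have "\<not> clear (cand i) (R / T)" using contra by blast
    then obtain j l y where jly: "j \<in> J" "l < n j" "y \<in> lattice" "\<epsilon> * (R / T) \<le> r j ^ l"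
        "N (cand i - hole j l y) \<le> R / T + 2 * S * r j ^ l"
      by (auto simp: clear_def not_less)
    have "r j ^ l < \<epsilon> * R"
    proof (rule ccontr)
      assume "\<not> ?thesis"
      then have "R + 2 * S * r j ^ l < N (x - hole j l y)"
        using assms(1) jly unfolding clear_def by (meson not_less)
      also have "\<dots> \<le> N (x - cand i) + N (cand i - hole j l y)" by (rule N_triangle_diff)
      also have "N (x - cand i) \<le> R - R / T" using \<open>N (cand i - x) \<le> R - R / T\<close> N_diff_commute by simp
      finally show False using jly by simp
    qed
    then show ?thesis using jly by auto
  qed
  then obtain jj ll yy where wit: "\<And>i. i \<le> k \<Longrightarrow> jj i \<in> J" "\<And>i. i \<le> k \<Longrightarrow> yy i \<in> lattice"
      "\<And>i. i \<le> k \<Longrightarrow> \<epsilon> * R / T \<le> r (jj i) ^ ll i" "\<And>i. i \<le> k \<Longrightarrow> r (jj i) ^ ll i < \<epsilon> * R"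
      "\<And>i. i \<le> k \<Longrightarrow> N (cand i - hole (jj i) (ll i) (yy i)) \<le> R / T + 2 * S * r (jj i) ^ ll i"
    by metis
  have "jj ` {..k} \<subseteq> J" using wit(1) by auto
  then have "card (jj ` {..k}) < card {..k}"
    using card_mono[OF finite_J, of "jj ` {..k}"] by (simp add: k_def)
  then have "\<not> inj_on jj {..k}" by (rule pigeonhole)
  then obtain i i' where ii: "i \<le> k" "i' \<le> k" "i \<noteq> i'" "jj i = jj i'"
    by (auto simp: inj_on_def)
  define j where "j = jj i"
  have jj: "jj i = j" "jj i' = j" using ii j_def by auto
  have j: "j \<in> J" using wit(1) ii j_def by auto
  have r: "T \<le> r j" "16 \<le> r j" using r_ge_T[OF j] T_ge by auto
  \<comment> \<open>The ratio \<open>T\<close> of this window is at most \<open>r j\<close>, so it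
    holds at most one power of \<open>r j\<close>.\<close>
  have no_less: "\<not> l < l'" if "\<epsilon> * R / T \<le> r j ^ l" "r j ^ l' < \<epsilon> * R" for l l'
  proof
    assume "l < l'"
    have "\<epsilon> * R = T * (\<epsilon> * R / T)" using T_ge by simp
    also have "\<dots> \<le> r j * r j ^ l"
      using that(1) r T_ge \<epsilon>_pos assms(2) by (intro mult_mono) auto
    also have "\<dots> = r j ^ Suc l" by simp
    also have "\<dots> \<le> r j ^ l'" using \<open>l < l'\<close> r by (intro power_increasing) auto
    finally show False using that(2) by simp
  qed
  have "ll i = ll i'"
    using no_less[of "ll i" "ll i'"] no_less[of "ll i'" "ll i"] wit(3,4)[OF ii(1)] wit(3,4)[OF ii(2)]
    unfolding jj by simp
  then obtain l where l: "ll i = l" "ll i' = l" by blast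
  define h where "h = R / T + 2 * S * r j ^ l"
  have h: "2 * h \<le> R / (4 * (real k + 1))"
  proof -
    have "2 * S * r j ^ l \<le> 2 * S * (\<epsilon> * R)"
      using wit(4)[OF ii(1)] S_ge_1 unfolding jj l by (intro mult_left_mono) auto
    then have "2 * h \<le> R * (2 / T + 4 * S * \<epsilon>)" by (simp add: h_def algebra_simps)
    then show ?thesis unfolding T_\<epsilon>_eq k_def by simp
  qed
  have near_hole: "N (cand i - hole j l (yy i)) \<le> h" "N (cand i' - hole j l (yy i')) \<le> h"
    using wit(5)[OF ii(1)] wit(5)[OF ii(2)] unfolding jj l h_def by auto
  show False
  proof (cases "yy i = yy i'")
    case True
    \<comment> \<open>One common hole: the two candidates would be at most \<open>2 * h\<close>
      apart, below the spacing.\<close>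
    have "1 * of_rat q \<le> N (cand i - cand i')"
      unfolding dist using ii(3) q_pos by (intro mult_right_mono) auto
    also have "\<dots> \<le> N (cand i - hole j l (yy i)) + N (hole j l (yy i') - cand i')"
      using N_triangle_diff True by metis
    also have "\<dots> \<le> 2 * h" using near_hole N_diff_commute by (metis add_mono mult_2)
    finally show False using h q(1) by simp
  next
    case False
    \<comment> \<open>Two holes: their centres are far apart by \<open>holes_separated\<close>, yet
      each is within \<open>h\<close> of a candidate and the candidates are at most \<open>R\<close>
      apart.\<close>
    have "r j * (\<epsilon> * R / T) \<le> r j ^ Suc l"
      using wit(3)[OF ii(1)] r unfolding jj l power_Suc by (intro mult_left_mono) auto
    then have "r j * (\<epsilon> * R / T) / C \<le> r j ^ Suc l / C"
      using C_ge_1 by (intro divide_right_mono) auto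
    also have "\<dots> \<le> N (hole j l (yy i) - hole j l (yy i'))"
      unfolding hole_def using wit(2) ii False r by (intro holes_separated sim j) auto
    also have "\<dots> \<le> N (hole j l (yy i) - cand i) + N (cand i - cand i') + N (cand i' - hole j l (yy i'))"
      using N_triangle_diff[of "hole j l (yy i)" "hole j l (yy i')" "cand i"]
        N_triangle_diff[of "cand i" "hole j l (yy i')" "cand i'"] by simp
    also have "\<dots> \<le> h + R + h"
      using near_hole near[OF ii(1)] near[OF ii(2)] N_triangle_diff[of "cand i" "cand i'" x]
        N_diff_commute[of x "cand i'"] N_diff_commute[of "hole j l (yy i)" "cand i"] by simp
    also have "2 * h \<le> R"
    proof -
      have "R / (4 * (real k + 1)) \<le> R / 1" using assms(2) by (intro divide_left_mono) auto
      then show ?thesis using h by simp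
    qed
    then have "h + R + h \<le> 2 * R" by simp
    finally have "r j * (\<epsilon> * R / T) / C \<le> 2 * R" .
    then have "r j \<le> 2 * (T * C / \<epsilon>)"
      using \<epsilon>_pos T_ge C_ge_1 assms(2) by (simp add: field_simps)
    then show False using r_large[OF j] by simp
  qed
qed

text \<open>The displacements of the rounds telescope.\<close>

lemma clear_iterate:
  assumes "clear x R" "0 < R"
  shows "\<exists>x'. N (x' - x) \<le> R - R / T ^ m \<and> clear x' (R / T ^ m)"
proof (induction m)
  case 0
  then show ?case using assms by (auto intro!: exI[of _ x] simp: N_0)
next
  case (Suc m)
  then obtain x' where x': "N (x' - x) \<le> R - R / T ^ m" "clear x' (R / T ^ m)" by blast
  have "0 < R / T ^ m" using assms(2) T_ge by simp
  from clear_step[OF x'(2) this] obtain x'' where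
    x'': "N (x'' - x') \<le> R / T ^ m - R / T ^ m / T" "clear x'' (R / T ^ m / T)" by blast
  have "N (x'' - x) \<le> R - R / T ^ m / T"
    using N_triangle_diff[of x'' x x'] x'(1) x''(1) by simp
  then show ?case using x''(2) by (auto simp: mult.commute)
qed

text \<open>At radius \<open>R\<close> all holes are too small to count, so the game starts
  vacuously. It stops at the first radius with \<open>\<epsilon> * (R / T ^ m) < 1\<close>, when
  every level counts; this radius is still at least \<open>S\<close>, so rounding the centre to the
  lattice stays inside the final ball.\<close>

lemma exists_missing:
  assumes "1 / \<epsilon> \<le> R" "\<And>j l. j \<in> J \<Longrightarrow> l < n j \<Longrightarrow> r j ^ l < \<epsilon> * R"
  shows "\<exists>z\<in>lattice. N (z - x) \<le> R \<and> (\<forall>j\<in>J. \<forall>l<n j. digit (b j) z l \<noteq> d j)"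
proof -
  have R: "0 < R" using assms(1) \<epsilon>_pos by (smt (verit) divide_pos_pos)
  have "clear x R" using assms(2) by (fastforce simp: clear_def)
  have "\<exists>m. \<epsilon> * R < T ^ m" using T_ge by (intro real_arch_pow) auto
  then have ex: "\<exists>m. \<epsilon> * (R / T ^ m) < 1" using T_ge by (simp add: divide_less_eq)
  define m where "m = (LEAST m. \<epsilon> * (R / T ^ m) < 1)"
  have m: "\<epsilon> * (R / T ^ m) < 1" using LeastI_ex[OF ex] by (simp add: m_def)
  have "m \<noteq> 0"
  proof
    assume "m = 0"
    then show False using m assms(1) \<epsilon>_pos by (simp add: field_simps)
  qed
  then obtain m' where m': "m = Suc m'" by (cases m) auto
  have "\<not> \<epsilon> * (R / T ^ m') < 1"
    using not_less_Least[of m' "\<lambda>m. \<epsilon> * (R / T ^ m) < 1"] m' m_def by simp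
  then have "1 / (\<epsilon> * T) \<le> R / T ^ m"
    using \<epsilon>_pos T_ge m' by (simp add: field_simps)
  then have S: "S \<le> R / T ^ m" using S_le by linarith
  obtain x' where x': "N (x' - x) \<le> R - R / T ^ m" "clear x' (R / T ^ m)"
    using clear_iterate[OF \<open>clear x R\<close> R] by blast
  show ?thesis
  proof (intro bexI conjI ballI allI impI)
    show "flr x' \<in> lattice" by (rule flr_in_lattice)
    have fl: "N (x' - flr x') \<le> R / T ^ m" using N_frac_le S order_trans by blast
    then show "N (flr x' - x) \<le> R"
      using N_triangle_diff[of "flr x'" x x'] x'(1) N_diff_commute[of x' "flr x'"] by simp
    fix j l assume j: "j \<in> J" and l: "l < n j"
    have r: "16 \<le> r j" using r_ge_T[OF j] T_ge by auto
    show "digit (b j) (flr x') l \<noteq> d j"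
    proof
      assume "digit (b j) (flr x') l = d j"
      then obtain y where y: "y \<in> lattice" "N (flr x' - hole j l y) \<le> 2 * S * r j ^ l"
        using digit_eq_imp_near[OF sim[OF j], of "flr x'" l "d j"] r unfolding hole_def by auto
      have "\<epsilon> * (R / T ^ m) \<le> r j ^ l"
        using m r one_le_power[of "r j" l] by linarith
      then have "R / T ^ m + 2 * S * r j ^ l < N (x' - hole j l y)"
        using x'(2) j l y(1) by (simp add: clear_def)
      also have "\<dots> \<le> N (x' - flr x') + N (flr x' - hole j l y)" by (rule N_triangle_diff)
      finally show False using fl y(2) by simp
    qed
  qed
qed

end

section \<open>Matching the parallelepipeds of several bases\<close>

context lattice_norm
begin

text \<open>By recurrence the powers \<open>b j ^ n j\<close> are nearly equal. The game is played
  around \<open>b j0 ^ n j0 * c\<close>, where \<open>c\<close> is the centre of the unit cube, so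
  \<open>z / b j ^ n j\<close> is close to \<open>c\<close> for every \<open>j\<close> and all
  expansions terminate. The bound \<open>X\<close> serves to produce infinitely many
  \<open>z\<close>.\<close>

lemma exists_joint_missing:
  fixes J :: "'i set" and b d :: "'i \<Rightarrow> 'a" and r :: "'i \<Rightarrow> real" and T \<epsilon> X :: real
  assumes finite_J: "finite J" and "J \<noteq> {}"
    and sim: "\<And>j. j \<in> J \<Longrightarrow> similarity (b j) (r j)"
    and T: "T = 16 * (real (card J) + 1)"
    and \<epsilon>: "\<epsilon> = 1 / (32 * S * (real (card J) + 1))"
    and r: "\<And>j. j \<in> J \<Longrightarrow> 2 * (T * C / \<epsilon>) < r j"
    and recur: "\<And>\<eta> n0. 0 < \<eta> \<Longrightarrow> \<exists>n :: 'i \<Rightarrow> nat. (\<forall>j\<in>J. n0 \<le> n j) \<and>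
      (\<forall>i\<in>J. \<forall>j\<in>J. \<forall>x. N (x * (b i ^ n i / b j ^ n j - 1)) \<le> \<eta> * N x)"
  shows "\<exists>z\<in>lattice. X < N z \<and>
    (\<forall>j\<in>J. \<exists>n>0. quot (b j) z n = 0 \<and> (\<forall>l<n. digit (b j) z l \<noteq> d j))"
proof -
  have \<epsilon>_pos: "0 < \<epsilon>" using S_ge_1 by (simp add: \<epsilon>)
  have T_ge: "16 \<le> T" by (simp add: T)
  have \<epsilon>_S: "32 * S \<le> 1 / \<epsilon>" using S_ge_1 by (simp add: \<epsilon>)
  have C_\<epsilon>: "32 * C / \<epsilon> \<le> 2 * (T * C / \<epsilon>)"
    using T_ge C_ge_1 \<epsilon>_pos by (simp add: divide_right_mono)
  have "32 * S * 32 * C \<le> 32 * C / \<epsilon>"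
    using mult_right_mono[OF \<epsilon>_S, of "32 * C"] C_ge_1 by simp
  then have r_SC: "32 * S * 32 * C < r j" if "j \<in> J" for j using r[OF that] C_\<epsilon> by linarith
  have SC: "1 \<le> S * C" using mult_mono[of 1 S 1 C] S_ge_1 C_ge_1 by simp
  have r16: "16 * S * C < r j" and r2: "2 \<le> r j" if "j \<in> J" for j
    using r_SC[OF that] SC by (auto simp: algebra_simps)
  \<comment> \<open>Chosen so that \<open>C * (2 * \<rho> + \<eta> * S) = 1 / 4\<close>, the
    tolerance of \<open>quot_eq_0\<close>.\<close>
  define \<rho> where "\<rho> = 1 / (16 * C)"
  define \<eta> where "\<eta> = 1 / (8 * C * S)"
  have \<rho>: "0 < \<rho>" using C_ge_1 by (simp add: \<rho>_def)
  have \<eta>: "0 < \<eta>" "\<eta> \<le> 1" using SC C_ge_1 S_ge_1 by (simp_all add: \<eta>_def divide_le_eq mult_ac)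
  \<comment> \<open>The first bound makes the starting ball large enough for the game, the second
    makes the norm of \<open>z\<close> exceed \<open>X\<close>.\<close>
  obtain n0 where n0: "max (1 / (\<epsilon> * \<rho>)) (4 * C * X) < 2 ^ n0"
    using real_arch_pow[of 2 "max (1 / (\<epsilon> * \<rho>)) (4 * C * X)"] by auto
  \<comment> \<open>\<open>Suc\<close> guarantees at least one digit in every base.\<close>
  obtain n where n: "\<And>j. j \<in> J \<Longrightarrow> Suc n0 \<le> n j"
    and near: "\<And>i j x. i \<in> J \<Longrightarrow> j \<in> J \<Longrightarrow> N (x * (b i ^ n i / b j ^ n j - 1)) \<le> \<eta> * N x"
    using recur[OF \<eta>(1), of "Suc n0"] by metis
  have b: "b j \<noteq> 0" if "j \<in> J" for j
    using similarity_nonzero[OF sim[OF that]] r2[OF that] by simp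
  have comparable: "r i ^ n i \<le> 2 * r j ^ n j" if "i \<in> J" "j \<in> J" for i j
  proof -
    have N_pow: "N (b i ^ n i) = r i ^ n i" if "i \<in> J" for i
      using similarity_power[OF sim[OF that], of "n i" 1] N_of_rat[of 1] by simp
    have "b i ^ n i = b j ^ n j * (b i ^ n i / b j ^ n j - 1) + b j ^ n j"
      using b[OF that(2)] by (simp add: right_diff_distrib)
    then have "N (b i ^ n i) \<le> N (b j ^ n j * (b i ^ n i / b j ^ n j - 1)) + N (b j ^ n j)"
      using N_triangle by metis
    also have "\<dots> \<le> \<eta> * N (b j ^ n j) + N (b j ^ n j)"
      using near[OF that] by simp
    also have "\<dots> \<le> 1 * N (b j ^ n j) + N (b j ^ n j)"
      using \<eta> N_nonneg by (intro add_mono mult_right_mono) auto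
    finally show ?thesis using N_pow that by simp
  qed
  obtain j0 where j0: "j0 \<in> J" using \<open>J \<noteq> {}\<close> by blast
  define A where "A = r j0 ^ n j0"
  have "2 ^ n0 \<le> (2::real) ^ n j0" using n[OF j0] by (intro power_increasing) auto
  also have "\<dots> \<le> A" unfolding A_def using r2[OF j0] by (intro power_mono) auto
  finally have A: "2 ^ n0 \<le> A" .
  then have "0 < A" by (metis less_le_trans zero_less_numeral zero_less_power)
  define c where "c = (\<Sum>w\<in>\<Omega>. of_rat (1 / 2) * w)"
  have coord_c: "coord c w = 1 / 2" if "w \<in> \<Omega>" for w
    unfolding c_def by (rule coord_sum[OF that])
  have N_c: "N c \<le> S" unfolding c_def by (rule N_sum_le) simp
  interpret digit_game \<Omega> coord N C S J b d r n T \<epsilon>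
    using finite_J sim T \<epsilon> r by unfold_locales auto
  have "\<exists>z\<in>lattice. N (z - b j0 ^ n j0 * c) \<le> \<rho> * A \<and>
      (\<forall>j\<in>J. \<forall>l<n j. digit (b j) z l \<noteq> d j)"
  proof (rule exists_missing)
    have "1 / (\<epsilon> * \<rho>) \<le> A" using n0 A by simp
    then show "1 / \<epsilon> \<le> \<rho> * A" using \<epsilon>_pos \<rho> by (simp add: field_simps)
    fix j l assume j: "j \<in> J" and l: "l < n j"
    have rj: "1 < r j" using r2[OF j] by simp
    \<comment> \<open>Here \<open>32 * C / \<epsilon>\<close> is
      \<open>2 / (\<epsilon> * \<rho>)\<close>, so even the top level \<open>n j - 1\<close> lies
      below the threshold at the start of the game.\<close>
    have "r j ^ l * (32 * C / \<epsilon>) < r j ^ l * r j"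
      using r[OF j] C_\<epsilon> rj by (intro mult_strict_left_mono) auto
    also have "\<dots> = r j ^ Suc l" by simp
    also have "\<dots> \<le> r j ^ n j" using l rj by (intro power_increasing) auto
    also have "\<dots> \<le> 2 * A" unfolding A_def by (rule comparable[OF j j0])
    finally show "r j ^ l < \<epsilon> * (\<rho> * A)"
      using \<epsilon>_pos C_ge_1 by (simp add: \<rho>_def field_simps)
  qed
  then obtain z where z: "z \<in> lattice" "N (z - b j0 ^ n j0 * c) \<le> \<rho> * A"
      "\<And>j l. j \<in> J \<Longrightarrow> l < n j \<Longrightarrow> digit (b j) z l \<noteq> d j"
    by blast
  have coord_z: "\<bar>coord (z / b j ^ n j) w - 1 / 2\<bar> \<le> 1 / 4" if j: "j \<in> J" and w: "w \<in> \<Omega>" for j w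
  proof -
    \<comment> \<open>\<open>u\<close> is the displacement inside the ball, \<open>v\<close> the
      mismatch between the powers of the bases \<open>j0\<close> and \<open>j\<close>.\<close>
    define u where "u = (z - b j0 ^ n j0 * c) / b j ^ n j"
    define v where "v = c * (b j0 ^ n j0 / b j ^ n j - 1)"
    have eq: "z / b j ^ n j - c = u + v"
      using b[OF j] by (simp add: u_def v_def field_simps)
    have "b j ^ n j * u = z - b j0 ^ n j0 * c" using b[OF j] by (simp add: u_def)
    then have "r j ^ n j * N u \<le> \<rho> * A"
      using z(2) similarity_power[OF sim[OF j], of "n j" u] by simp
    also have "\<dots> \<le> \<rho> * (2 * r j ^ n j)"
      unfolding A_def using comparable[OF j0 j] \<rho> by (intro mult_left_mono) auto
    finally have "r j ^ n j * N u \<le> r j ^ n j * (2 * \<rho>)" by (simp add: mult_ac)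
    then have u: "N u \<le> 2 * \<rho>" using r2[OF j] by (subst (asm) mult_le_cancel_left_pos) auto
    have "N v \<le> \<eta> * N c" unfolding v_def by (rule near[OF j0 j])
    also have "\<dots> \<le> \<eta> * S" using N_c \<eta> by (intro mult_left_mono) auto
    finally have "N (u + v) \<le> 2 * \<rho> + \<eta> * S" using N_triangle[of u v] u by linarith
    then have "C * N (u + v) \<le> C * (2 * \<rho> + \<eta> * S)" using C_ge_1 by (intro mult_left_mono) auto
    also have "\<dots> = 1 / 4" using C_ge_1 S_ge_1 by (simp add: \<rho>_def \<eta>_def field_simps)
    finally have "\<bar>of_rat (coord (z / b j ^ n j - c) w) :: real\<bar> \<le> of_rat (1 / 4)"
      using coord_le[OF w, of "u + v"] unfolding eq by (simp add: of_rat_divide)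
    then have "\<bar>coord (z / b j ^ n j - c) w\<bar> \<le> 1 / 4"
      by (metis abs_of_rat of_rat_less_eq)
    then show ?thesis using coord_diff[OF w] coord_c[OF w] by simp
  qed
  have quot: "quot (b j) z (n j) = 0" if "j \<in> J" for j
    using quot_eq_0[OF sim[OF that] r2[OF that] r16[OF that] _ coord_z[OF that]] n[OF that] by simp
  have "\<Omega> \<noteq> {}" using sum_coord[of 1] by auto
  then obtain w where w: "w \<in> \<Omega>" by blast
  \<comment> \<open>A coordinate of at least 1/4 keeps \<open>z\<close> away from 0 at the scale
    \<open>A\<close>.\<close>
  have "1 / 4 \<le> coord (z / b j0 ^ n j0) w" using coord_z[OF j0 w] by linarith
  then have "of_rat (1 / 4) \<le> (of_rat (coord (z / b j0 ^ n j0) w) :: real)" by (simp only: of_rat_less_eq)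
  also have "\<dots> \<le> C * N (z / b j0 ^ n j0)" using coord_le[OF w, of "z / b j0 ^ n j0"] by linarith
  finally have "1 / 4 \<le> C * N (z / b j0 ^ n j0)" by (simp add: of_rat_divide)
  then have "A * (1 / 4) \<le> A * (C * N (z / b j0 ^ n j0))" using \<open>0 < A\<close> by (intro mult_left_mono) auto
  also have "\<dots> = C * N (b j0 ^ n j0 * (z / b j0 ^ n j0))"
    by (simp only: similarity_power[OF sim[OF j0]] A_def mult.left_commute)
  also have "\<dots> = C * N z" using b[OF j0] by simp
  finally have "A * (1 / 4) \<le> C * N z" .
  moreover have "4 * C * X < A" using n0 A by simp
  ultimately have "C * X < C * N z" by simp
  then have "X < N z" using C_ge_1 by simp
  moreover have "0 < n j" if "j \<in> J" for j using n[OF that] by simp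
  ultimately show ?thesis
    using z(1,3) quot by (intro bexI[of _ z]) (auto intro!: exI[of _ "n _"])
qed

end

subsection \<open>Number fields\<close>

lemma of_real_of_rat: "complex_of_real (of_rat q) = of_rat q"
  by (cases q) (simp add: of_rat_rat)

lemma norm_of_rat: "norm (of_rat q :: complex) = \<bar>of_rat q\<bar>"
  by (metis norm_of_real of_real_of_rat)

lemma embedding_of_rat:
  assumes "\<sigma> \<in> embeddings"
  shows "\<sigma> (of_rat q) = of_rat q"
proof -
  have "\<sigma> (of_rat q) = \<sigma> (of_rat 1) * of_rat q"
    by (rule additive_rat_linear) (use assms in \<open>auto simp: embeddings_def of_rat_add\<close>)
  then show ?thesis using assms by (simp add: embeddings_def)
qed

lemma embedding_add: "\<sigma> \<in> embeddings \<Longrightarrow> \<sigma> (x + y) = \<sigma> x + \<sigma> y"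
  and embedding_mult: "\<sigma> \<in> embeddings \<Longrightarrow> \<sigma> (x * y) = \<sigma> x * \<sigma> y"
  and embedding_1: "\<sigma> \<in> embeddings \<Longrightarrow> \<sigma> 1 = 1"
  by (simp_all add: embeddings_def)

lemma embedding_0: "\<sigma> \<in> embeddings \<Longrightarrow> \<sigma> 0 = 0"
  using embedding_of_rat[of \<sigma> 0] by simp

lemma embedding_minus: "\<sigma> \<in> embeddings \<Longrightarrow> \<sigma> (- x) = - \<sigma> x"
  using embedding_add[of \<sigma> x "- x"] embedding_0[of \<sigma>] by (simp add: eq_neg_iff_add_eq_0 add.commute)

lemma embedding_sum: "\<sigma> \<in> embeddings \<Longrightarrow> \<sigma> (sum f A) = (\<Sum>a\<in>A. \<sigma> (f a))"
  by (induction A rule: infinite_finite_induct) (simp_all add: embedding_0 embedding_add)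

lemma embedding_eq_0:
  assumes "\<sigma> \<in> embeddings" "\<sigma> x = 0"
  shows "x = 0"
proof (rule ccontr)
  assume "x \<noteq> 0"
  then have "\<sigma> 1 = \<sigma> x * \<sigma> (inverse x)" using embedding_mult[OF assms(1), of x "inverse x"] by simp
  then show False using assms embedding_1[OF assms(1)] by simp
qed

lemma embedding_power: "\<sigma> \<in> embeddings \<Longrightarrow> \<sigma> (x ^ n) = \<sigma> x ^ n"
  by (induction n) (simp_all add: embedding_1 embedding_mult)

lemma embedding_divide:
  assumes "\<sigma> \<in> embeddings"
  shows "\<sigma> (x / y) = \<sigma> x / \<sigma> y"
proof (cases "y = 0")
  case False
  then have "\<sigma> x = \<sigma> (x / y) * \<sigma> y" using embedding_mult[OF assms, of "x / y" y] by simp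
  then show ?thesis using embedding_eq_0[OF assms] False by auto
qed (simp add: embedding_0 assms)

lemma hom_on_UNIV: "hom_on UNIV \<sigma> \<longleftrightarrow> \<sigma> \<in> embeddings"
  by (auto simp: hom_on_def embeddings_def)

section \<open>Coordinates and conjugates in a number field\<close>

text \<open>The assumptions on the set of embeddings are settled by a case distinction in the final
  theorem: if they fail, every field norm is 1.\<close>

locale number_field_basis =
  fixes \<Omega> :: "'a::field_char_0 set"
  assumes number_field: "number_field TYPE('a)"
    and basis: "integral_basis \<Omega>"
    and mult_closed: "\<And>x y :: 'a. x \<in> integers_of TYPE('a) \<Longrightarrow> y \<in> integers_of TYPE('a) \<Longrightarrow>
      x * y \<in> integers_of TYPE('a)"
    and finite_embeddings: "finite (embeddings :: ('a \<Rightarrow> complex) set)"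
    and embeddings_nonempty: "(embeddings :: ('a \<Rightarrow> complex) set) \<noteq> {}"
begin

interpretation V: vector_space "\<lambda>(q::rat) (x::'a). of_rat q * x"
  by unfold_locales (simp_all add: algebra_simps of_rat_add of_rat_mult)

interpretation Z: Modules.module "\<lambda>(n::int) (x::'a). of_int n * x"
  by unfold_locales (simp_all add: algebra_simps)

lemma finite_\<Omega>: "finite \<Omega>"
  using basis by (simp add: integral_basis_def)

lemma integers_eq: "integers_of TYPE('a) = range (\<lambda>u :: 'a \<Rightarrow> int. \<Sum>w\<in>\<Omega>. of_int (u w) * w)"
  using basis Z.span_finite[OF finite_\<Omega>] by (simp add: integral_basis_def)

text \<open>A common denominator turns a rational relation into an integral one.\<close>

lemma independent_\<Omega>: "V.independent \<Omega>"
proof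
  assume "V.dependent \<Omega>"
  then obtain u w where u: "w \<in> \<Omega>" "u w \<noteq> 0" "(\<Sum>v\<in>\<Omega>. of_rat (u v) * v) = 0"
    unfolding V.dependent_finite[OF finite_\<Omega>] by blast
  obtain D :: int where D: "D \<noteq> 0" "\<And>v. v \<in> \<Omega> \<Longrightarrow> of_int D * u v \<in> \<int>"
    using common_denominator[OF finite_\<Omega>] by blast
  define k where "k v = \<lfloor>of_int D * u v\<rfloor>" for v
  have k: "of_int (k v) = of_int D * u v" if "v \<in> \<Omega>" for v
    using D(2)[OF that] by (simp add: k_def)
  have "(of_int (k v) :: 'a) = of_int D * of_rat (u v)" if "v \<in> \<Omega>" for v
    using arg_cong[OF k[OF that], of "of_rat :: rat \<Rightarrow> 'a"] by (simp add: of_rat_mult)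
  then have "(\<Sum>v\<in>\<Omega>. of_int (k v) * v) = (\<Sum>v\<in>\<Omega>. of_int D * (of_rat (u v) * v))"
    by (intro sum.cong) (simp_all add: mult.assoc)
  also have "\<dots> = 0" by (simp only: sum_distrib_left[symmetric] u(3)) simp
  finally have "(\<Sum>v\<in>\<Omega>. of_int (k v) * v) = 0" .
  moreover have "k w \<noteq> 0" using k[OF u(1)] D(1) u(2) by force
  ultimately have "Z.dependent \<Omega>" unfolding Z.dependent_finite[OF finite_\<Omega>] using u(1) by blast
  then show False using basis by (simp add: integral_basis_def)
qed

text \<open>Every element has a nonzero integer multiple that is an algebraic integer.\<close>

lemma span_\<Omega>: "V.span \<Omega> = UNIV"
proof (intro equalityI subsetI UNIV_I)
  fix x :: 'a
  obtain c :: int where c: "c \<noteq> 0" "algebraic_int (of_int c * x)"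
    using algebraic_integral_multiple[OF number_field_algebraic[OF number_field, of x]] by blast
  then obtain u :: "'a \<Rightarrow> int" where u: "of_int c * x = (\<Sum>w\<in>\<Omega>. of_int (u w) * w)"
    using integers_eq by (auto simp: integers_of_def)
  have "x = of_rat (inverse (of_int c)) * (of_int c * x)"
    using c(1) by (simp add: of_rat_inverse)
  also have "of_int c * x = (\<Sum>w\<in>\<Omega>. of_rat (of_int (u w)) * w)" using u by simp
  finally show "x \<in> V.span \<Omega>"
    by (metis (no_types, lifting) V.span_base V.span_scale V.span_sum)
qed

definition crd :: "'a \<Rightarrow> 'a \<Rightarrow> rat" where
  "crd x w = V.representation \<Omega> x w"

text \<open>The house of an algebraic number, that is, the maximum norm of its Minkowski
  image.\<close>

definition height :: "'a \<Rightarrow> real" where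
  "height x = Max ((\<lambda>\<sigma>. norm (\<sigma> x)) ` embeddings)"

lemma sum_crd: "(\<Sum>w\<in>\<Omega>. of_rat (crd x w) * w) = x"
  unfolding crd_def
  by (rule V.sum_representation_eq[OF independent_\<Omega>]) (use span_\<Omega> finite_\<Omega> in auto)

lemma crd_sum:
  assumes "w \<in> \<Omega>"
  shows "crd (\<Sum>v\<in>\<Omega>. of_rat (u v) * v) w = u w"
proof -
  have "V.representation \<Omega> (\<Sum>v\<in>\<Omega>. of_rat (u v) * v) = (\<lambda>v. if v \<in> \<Omega> then u v else 0)"
  proof (rule V.representation_eqI[OF independent_\<Omega>])
    have "(\<Sum>v | (if v \<in> \<Omega> then u v else 0) \<noteq> 0. of_rat (if v \<in> \<Omega> then u v else 0) * v) =
        (\<Sum>v\<in>\<Omega>. of_rat (if v \<in> \<Omega> then u v else 0) * v)"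
      using finite_\<Omega> by (intro sum.mono_neutral_left) (auto split: if_splits)
    then show "(\<Sum>v | (if v \<in> \<Omega> then u v else 0) \<noteq> 0. of_rat (if v \<in> \<Omega> then u v else 0) * v) =
        (\<Sum>v\<in>\<Omega>. of_rat (u v) * v)" by simp
  qed (use span_\<Omega> finite_\<Omega> in \<open>auto split: if_splits\<close>)
  then show ?thesis using assms by (simp add: crd_def)
qed

lemma crd_add: "crd (x + y) w = crd x w + crd y w"
  using V.representation_add[OF independent_\<Omega>, of y x] span_\<Omega> by (simp add: crd_def add.commute)

lemma height_ge: "\<sigma> \<in> embeddings \<Longrightarrow> norm (\<sigma> x) \<le> height x"
  unfolding height_def using finite_embeddings by (intro Max_ge) auto

lemma height_leI: "(\<And>\<sigma>. \<sigma> \<in> embeddings \<Longrightarrow> norm (\<sigma> x) \<le> c) \<Longrightarrow> height x \<le> c"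
  unfolding height_def using finite_embeddings embeddings_nonempty by (intro Max.boundedI) auto

lemma height_attained: "\<exists>\<sigma>\<in>embeddings. height x = norm (\<sigma> x)"
  unfolding height_def
  using Max_in[of "(\<lambda>\<sigma>. norm (\<sigma> x)) ` embeddings"] finite_embeddings embeddings_nonempty
  by (metis (no_types, lifting) finite_imageI image_iff image_is_empty)

text \<open>The lower bound comes from an embedding at which \<open>x\<close> attains its
  height.\<close>

lemma height_mult_const:
  assumes "\<And>\<sigma>. \<sigma> \<in> embeddings \<Longrightarrow> norm (\<sigma> b) = c"
  shows "height (b * x) = c * height x"
proof -
  obtain \<sigma> :: "'a \<Rightarrow> complex" where "\<sigma> \<in> embeddings" using embeddings_nonempty by blast
  then have "0 \<le> c" using assms norm_ge_zero by metis
  have "height (b * x) \<le> c * height x"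
    using assms height_ge \<open>0 \<le> c\<close> by (intro height_leI) (simp add: embedding_mult norm_mult mult_left_mono)
  moreover obtain \<sigma> where \<sigma>: "\<sigma> \<in> embeddings" "height x = norm (\<sigma> x)" using height_attained by blast
  then have "c * height x \<le> height (b * x)"
    using height_ge[OF \<sigma>(1), of "b * x"] assms[OF \<sigma>(1)] by (simp add: embedding_mult norm_mult)
  ultimately show ?thesis by simp
qed

lemma height_triangle: "height (x + y) \<le> height x + height y"
proof (rule height_leI)
  fix \<sigma> :: "'a \<Rightarrow> complex" assume "\<sigma> \<in> embeddings"
  then show "norm (\<sigma> (x + y)) \<le> height x + height y"
    using norm_triangle_ineq[of "\<sigma> x" "\<sigma> y"] height_ge[of \<sigma> x] height_ge[of \<sigma> y]
    by (simp add: embedding_add)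
qed

lemma height_nonneg: "0 \<le> height x"
  using embeddings_nonempty height_ge norm_ge_zero by (meson ex_in_conv order_trans)

lemma height_of_rat_mult: "height (of_rat q * x) = \<bar>of_rat q\<bar> * height x"
  by (rule height_mult_const) (simp add: embedding_of_rat norm_of_rat)

lemma height_1: "height 1 = 1"
  using height_attained[of 1] by (auto simp: embedding_1)

lemma hom_combination_bound:
  assumes "hom_combination UNIV \<phi>"
  shows "\<exists>C\<ge>0. \<forall>x :: 'a. norm (\<phi> x) \<le> C * height x"
  using assms
proof (induction rule: hom_combination.induct)
  case (zero \<phi>)
  then show ?case by (intro exI[of _ 0]) simp
next
  case (step \<sigma> \<psi> \<phi> c)
  then obtain C where C: "0 \<le> C" "\<And>x. norm (\<psi> x) \<le> C * height x" by blast
  have "norm (\<phi> x) \<le> (norm c + C) * height x" for x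
  proof -
    have "norm (\<phi> x) \<le> norm c * norm (\<sigma> x) + norm (\<psi> x)"
      using norm_triangle_ineq[of "c * \<sigma> x" "\<psi> x"] step.hyps(3) by (simp add: norm_mult)
    also have "\<dots> \<le> norm c * height x + C * height x"
      using step.hyps(1) C(2) height_ge by (intro add_mono mult_left_mono) (auto simp: hom_on_UNIV)
    finally show ?thesis by (simp add: distrib_right)
  qed
  then show ?case using C(1) by (intro exI[of _ "norm c + C"]) simp
qed

text \<open>A coordinate is an additive map into the complex numbers, hence a combination of
  embeddings, and each of these is bounded by the height.\<close>

lemma crd_bound: "\<exists>C\<ge>0. \<forall>x. \<bar>of_rat (crd x w) :: real\<bar> \<le> C * height x"
proof -
  have "hom_combination UNIV (\<lambda>x. of_rat (crd x w) :: complex)"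
    by (rule number_field_additive[OF number_field]) (simp add: crd_add of_rat_add)
  from hom_combination_bound[OF this] show ?thesis by (simp add: norm_of_rat)
qed

definition crd_const :: real where
  "crd_const = (SOME C. 1 \<le> C \<and> (\<forall>w\<in>\<Omega>. \<forall>x. \<bar>of_rat (crd x w)\<bar> \<le> C * height x))"

lemma crd_const: "1 \<le> crd_const" "w \<in> \<Omega> \<Longrightarrow> \<bar>of_rat (crd x w)\<bar> \<le> crd_const * height x"
proof -
  obtain c where c: "\<And>w. 0 \<le> c w" "\<And>w x. \<bar>of_rat (crd x w) :: real\<bar> \<le> c w * height x"
    using crd_bound by metis
  \<comment> \<open>The sum serves all basis elements at once; the summand 1 makes the constant at
    least 1.\<close>
  have "\<bar>of_rat (crd x w) :: real\<bar> \<le> (1 + sum c \<Omega>) * height x" if "w \<in> \<Omega>" for w x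
  proof -
    have "c w \<le> sum c \<Omega>" using that finite_\<Omega> c(1) by (intro member_le_sum) auto
    then have "c w * height x \<le> (1 + sum c \<Omega>) * height x" using height_nonneg by (intro mult_right_mono) auto
    then show ?thesis using c(2)[of x w] by linarith
  qed
  moreover have "1 \<le> 1 + sum c \<Omega>" using c(1) by (simp add: sum_nonneg)
  ultimately have "\<exists>C. 1 \<le> C \<and> (\<forall>w\<in>\<Omega>. \<forall>x. \<bar>of_rat (crd x w) :: real\<bar> \<le> C * height x)" by blast
  from someI_ex[OF this, folded crd_const_def]
  show "1 \<le> crd_const" "w \<in> \<Omega> \<Longrightarrow> \<bar>of_rat (crd x w)\<bar> \<le> crd_const * height x" by auto
qed

lemma height_sum: "finite A \<Longrightarrow> height (sum f A) \<le> (\<Sum>a\<in>A. height (f a))"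
proof (induction rule: finite_induct)
  case empty
  then show ?case using height_of_rat_mult[of 0 1] by simp
next
  case (insert a A)
  then show ?case using height_triangle[of "f a" "sum f A"] by simp
qed

sublocale lattice_norm \<Omega> crd height crd_const "1 + (\<Sum>w\<in>\<Omega>. height w)"
proof
  show "height (- x) = height x" for x using height_of_rat_mult[of "-1" x] by simp
  show "height (of_rat q) = \<bar>of_rat q\<bar>" for q using height_of_rat_mult[of q 1] by (simp add: height_1)
  fix u :: "'a \<Rightarrow> rat" assume u: "\<And>w. w \<in> \<Omega> \<Longrightarrow> \<bar>u w\<bar> \<le> 1"
  have "height (\<Sum>w\<in>\<Omega>. of_rat (u w) * w) \<le> (\<Sum>w\<in>\<Omega>. \<bar>of_rat (u w)\<bar> * height w)"
    using height_sum[OF finite_\<Omega>, of "\<lambda>w. of_rat (u w) * w"] by (simp add: height_of_rat_mult)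
  also have "\<dots> \<le> (\<Sum>w\<in>\<Omega>. 1 * height w)"
  proof (intro sum_mono mult_right_mono height_nonneg)
    fix w assume "w \<in> \<Omega>"
    then have "(of_rat \<bar>u w\<bar> :: real) \<le> of_rat 1" using u by (simp only: of_rat_less_eq)
    then show "\<bar>of_rat (u w) :: real\<bar> \<le> 1" by simp
  qed
  finally show "height (\<Sum>w\<in>\<Omega>. of_rat (u w) * w) \<le> 1 + (\<Sum>w\<in>\<Omega>. height w)" by simp
qed (use finite_\<Omega> sum_crd crd_sum height_triangle crd_const height_nonneg in \<open>auto intro: sum_nonneg\<close>)

section \<open>Integers, digits and norms in a number field\<close>

lemma lattice_eq: "lattice = integers_of TYPE('a)"
proof (intro equalityI subsetI)
  fix x assume "x \<in> lattice"
  then have "\<And>w. w \<in> \<Omega> \<Longrightarrow> crd x w = of_int \<lfloor>crd x w\<rfloor>" by (auto simp: lattice_def elim: Ints_cases)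
  then have "x = (\<Sum>w\<in>\<Omega>. of_int \<lfloor>crd x w\<rfloor> * w)"
    by (subst sum_crd[of x, symmetric]) (metis (mono_tags, lifting) of_rat_of_int_eq sum.cong)
  then show "x \<in> integers_of TYPE('a)" unfolding integers_eq
    by (intro range_eqI[where x = "\<lambda>w. \<lfloor>crd x w\<rfloor>"])
next
  fix x :: 'a assume "x \<in> integers_of TYPE('a)"
  then obtain u :: "'a \<Rightarrow> int" where "x = (\<Sum>w\<in>\<Omega>. of_rat (of_int (u w)) * w)"
    unfolding integers_eq by auto
  then have "crd x w = of_int (u w)" if "w \<in> \<Omega>" for w
    using crd_sum[OF that, of "\<lambda>w. of_int (u w)"] by simp
  then show "x \<in> lattice" by (simp add: lattice_def)
qed

lemma quot_in_lattice: "z \<in> lattice \<Longrightarrow> quot b z l \<in> lattice"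
  by (cases l) (auto simp: flr_in_lattice)

text \<open>The parallelepiped coordinates \<open>t\<close> are the fractional parts of the
  coordinates of \<open>quot b z l / b\<close>.\<close>

lemma digit_in_digit_set:
  assumes "b \<in> lattice" "b \<noteq> 0" "z \<in> lattice"
  shows "digit b z l \<in> digit_set \<Omega> b"
  unfolding digit_set_def
proof (intro CollectI conjI exI ballI)
  let ?y = "quot b z l / b"
  have "b * quot b z (Suc l) \<in> lattice"
    using assms(1) quot_in_lattice[OF assms(3), of b "Suc l"] mult_closed unfolding lattice_eq by blast
  then show "digit b z l \<in> integers_of TYPE('a)"
    using lattice_diff quot_in_lattice[OF assms(3)] unfolding digit_def lattice_eq[symmetric] by blast
  show "0 \<le> (of_rat (frac (crd ?y w)) :: real)" for w by simp
  show "(of_rat (frac (crd ?y w)) :: real) < 1" for w using frac_lt_1 by simp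
  fix \<sigma> :: "'a \<Rightarrow> complex" assume \<sigma>: "\<sigma> \<in> embeddings"
  have "?y - flr ?y = (\<Sum>w\<in>\<Omega>. of_rat (frac (crd ?y w)) * w)"
    by (rule coord_eqI) (simp only: coord_diff coord_flr coord_sum frac_def)
  then have "digit b z l = b * (\<Sum>w\<in>\<Omega>. of_rat (frac (crd ?y w)) * w)"
    using assms(2) by (simp add: digit_def right_diff_distrib flip: \<open>_ = (\<Sum>w\<in>\<Omega>. _)\<close>)
  also have "\<dots> = (\<Sum>w\<in>\<Omega>. of_rat (frac (crd ?y w)) * (b * w))"
    by (simp add: sum_distrib_left mult_ac)
  finally show "\<sigma> (digit b z l) = (\<Sum>w\<in>\<Omega>. complex_of_real (of_rat (frac (crd ?y w))) * \<sigma> (b * w))"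
    using \<sigma> by (simp add: embedding_sum embedding_mult[of _ "of_rat _"] embedding_of_rat of_real_of_rat)
qed

lemma misses_digitI:
  assumes "b \<in> lattice" "b \<noteq> 0" "z \<in> lattice" "0 < n" "quot b z n = 0" "\<And>l. l < n \<Longrightarrow> digit b z l \<noteq> d"
  shows "misses_digit \<Omega> b d z"
proof -
  \<comment> \<open>\<open>misses_digit\<close> sums up to \<open>m\<close> inclusive, so
    \<open>n\<close> digits mean \<open>m = n - 1\<close>.\<close>
  obtain m where m: "n = Suc m" using assms(4) by (cases n) auto
  have "z = (\<Sum>l<n. digit b z l * b ^ l)" using expansion[of b z n] assms(5) by simp
  then have "z = (\<Sum>l\<le>m. digit b z l * b ^ l)" by (simp only: m lessThan_Suc_atMost)
  then show ?thesis
    unfolding misses_digit_def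
    using digit_in_digit_set[OF assms(1-3)] assms(6) m by (intro exI[of _ m] exI[of _ "digit b z"]) auto
qed

text \<open>A lower bound on the norm of \<open>b\<close> thereby becomes one on the common absolute
  value \<open>r\<close>.\<close>

lemma norm_embedding_eq:
  fixes b :: 'a
  assumes "equal_norm_embeddings b"
  obtains r where "\<And>\<sigma>. \<sigma> \<in> embeddings \<Longrightarrow> norm (\<sigma> b) = r"
    "norm (field_norm b) = r ^ card (embeddings :: ('a \<Rightarrow> complex) set)"
proof -
  obtain \<sigma>0 :: "'a \<Rightarrow> complex" where \<sigma>0: "\<sigma>0 \<in> embeddings" using embeddings_nonempty by blast
  have r: "norm (\<sigma> b) = norm (\<sigma>0 b)" if "\<sigma> \<in> embeddings" for \<sigma> :: "'a \<Rightarrow> complex"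
    using assms \<sigma>0 that unfolding equal_norm_embeddings_def by blast
  have "norm (field_norm b) = (\<Prod>\<sigma>\<in>embeddings. norm (\<sigma> b))"
    unfolding field_norm_def by (rule prod_norm[symmetric])
  also have "\<dots> = (\<Prod>\<sigma>\<in>(embeddings :: ('a \<Rightarrow> complex) set). norm (\<sigma>0 b))"
    by (intro prod.cong refl r)
  finally have "norm (field_norm b) = norm (\<sigma>0 b) ^ card (embeddings :: ('a \<Rightarrow> complex) set)"
    by simp
  with r show ?thesis by (rule that[of "norm (\<sigma>0 b)"])
qed

text \<open>The threshold \<open>(R + 2) ^ e\<close> on norms gives \<open>r j \<ge> R + 2\<close>,
  where \<open>R\<close> is what the game requires and the surplus also yields
  \<open>r j > 1\<close>. Solutions of arbitrarily large height exist, so there are infinitely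
  many.\<close>

lemma infinitely_many_missing:
  fixes k :: nat
  assumes "k \<ge> 1"
  shows "\<exists>M>0. \<forall>b d :: nat \<Rightarrow> 'a.
      (\<forall>j\<in>{1..k}. b j \<in> integers_of TYPE('a) \<and> equal_norm_embeddings (b j) \<and> norm (field_norm (b j)) \<ge> M)
      \<longrightarrow> infinite {z \<in> integers_of TYPE('a). \<forall>j\<in>{1..k}. misses_digit \<Omega> (b j) (d j) z}"
proof -
  define e where "e = card (embeddings :: ('a \<Rightarrow> complex) set)"
  have "e \<noteq> 0" using finite_embeddings embeddings_nonempty by (simp add: e_def)
  define S where "S = 1 + (\<Sum>w\<in>\<Omega>. height w)"
  define T where "T = 16 * (real k + 1)"
  define \<epsilon> where "\<epsilon> = 1 / (32 * S * (real k + 1))"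
  define R where "R = 2 * (T * crd_const / \<epsilon>)"
  have "0 \<le> R" using C_ge_1 S_ge_1 by (simp add: R_def T_def \<epsilon>_def S_def)
  show ?thesis
  proof (intro exI[of _ "(R + 2) ^ e"] conjI allI impI)
    show "0 < (R + 2) ^ e" using \<open>0 \<le> R\<close> by simp
    fix b d :: "nat \<Rightarrow> 'a"
    assume b: "\<forall>j\<in>{1..k}. b j \<in> integers_of TYPE('a) \<and> equal_norm_embeddings (b j) \<and>
      norm (field_norm (b j)) \<ge> (R + 2) ^ e"
    have "\<forall>j\<in>{1..k}. \<exists>r. (\<forall>\<sigma>\<in>embeddings. norm (\<sigma> (b j)) = r) \<and> norm (field_norm (b j)) = r ^ e"
      using b norm_embedding_eq unfolding e_def by metis
    then obtain r where r: "\<And>j \<sigma>. j \<in> {1..k} \<Longrightarrow> \<sigma> \<in> embeddings \<Longrightarrow> norm (\<sigma> (b j)) = r j"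
        "\<And>j. j \<in> {1..k} \<Longrightarrow> norm (field_norm (b j)) = r j ^ e"
      by metis
    have r_ge: "R + 2 \<le> r j" if "j \<in> {1..k}" for j
    proof -
      obtain e' where e': "e = Suc e'" using \<open>e \<noteq> 0\<close> by (cases e) auto
      obtain \<sigma> :: "'a \<Rightarrow> complex" where "\<sigma> \<in> embeddings" using embeddings_nonempty by blast
      then have "0 \<le> r j" using r(1)[OF that] norm_ge_zero by metis
      moreover have "(R + 2) ^ Suc e' \<le> r j ^ Suc e'" using b r(2) that e' by metis
      ultimately show ?thesis using power_le_imp_le_base by blast
    qed
    have sim: "similarity (b j) (r j)" if "j \<in> {1..k}" for j
      unfolding similarity_def using height_mult_const r(1)[OF that] by blast
    have b_nz: "b j \<noteq> 0" if "j \<in> {1..k}" for j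
      using similarity_nonzero[OF sim[OF that]] r_ge[OF that] \<open>0 \<le> R\<close> by simp
    have recur: "\<exists>n :: nat \<Rightarrow> nat. (\<forall>j\<in>{1..k}. n0 \<le> n j) \<and>
        (\<forall>i\<in>{1..k}. \<forall>j\<in>{1..k}. \<forall>x. height (x * (b i ^ n i / b j ^ n j - 1)) \<le> \<eta> * height x)"
      if "0 < \<eta>" for \<eta> n0
    proof -
      have "\<exists>n. (\<forall>j\<in>{1..k}. n0 \<le> n j) \<and> (\<forall>i\<in>{1..k}. \<forall>j\<in>{1..k}. \<forall>\<sigma>\<in>embeddings.
          norm ((\<lambda>j \<sigma>. \<sigma> (b j)) i \<sigma> ^ n i / (\<lambda>j \<sigma>. \<sigma> (b j)) j \<sigma> ^ n j - 1) \<le> \<eta>)"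
      proof (rule simultaneous_powers)
        show "1 < r j" if "j \<in> {1..k}" for j using r_ge[OF that] \<open>0 \<le> R\<close> by simp
      qed (use r(1) finite_embeddings that in auto)
      then obtain n where n: "\<And>j. j \<in> {1..k} \<Longrightarrow> n0 \<le> n j"
        "\<And>i j \<sigma>. i \<in> {1..k} \<Longrightarrow> j \<in> {1..k} \<Longrightarrow> \<sigma> \<in> embeddings \<Longrightarrow>
          norm (\<sigma> (b i) ^ n i / \<sigma> (b j) ^ n j - 1) \<le> \<eta>" by blast
      have "height (x * (b i ^ n i / b j ^ n j - 1)) \<le> \<eta> * height x"
        if ij: "i \<in> {1..k}" "j \<in> {1..k}" for i j x
      proof (rule height_leI)
        fix \<sigma> :: "'a \<Rightarrow> complex" assume \<sigma>: "\<sigma> \<in> embeddings"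
        have "\<sigma> (b i ^ n i / b j ^ n j - 1) = \<sigma> (b i) ^ n i / \<sigma> (b j) ^ n j - 1"
          using embedding_add[OF \<sigma>, of "b i ^ n i / b j ^ n j" "- 1"]
          by (simp add: \<sigma> embedding_divide embedding_power embedding_minus embedding_1)
        then have "norm (\<sigma> (x * (b i ^ n i / b j ^ n j - 1))) \<le> height x * \<eta>"
          using n(2)[OF ij \<sigma>] height_ge[OF \<sigma>] height_nonneg
          by (simp add: embedding_mult[OF \<sigma>] norm_mult mult_mono)
        then show "norm (\<sigma> (x * (b i ^ n i / b j ^ n j - 1))) \<le> \<eta> * height x" by (simp add: mult.commute)
      qed
      then show ?thesis using n(1) by blast
    qed
    have large: "\<exists>z \<in> {z \<in> integers_of TYPE('a). \<forall>j\<in>{1..k}. misses_digit \<Omega> (b j) (d j) z}. X < height z" for X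
    proof -
      have "\<exists>z\<in>lattice. X < height z \<and>
          (\<forall>j\<in>{1..k}. \<exists>n>0. quot (b j) z n = 0 \<and> (\<forall>l<n. digit (b j) z l \<noteq> d j))"
      proof (rule exists_joint_missing[OF _ _ sim])
        show "2 * (T * crd_const / \<epsilon>) < r j" if "j \<in> {1..k}" for j using r_ge[OF that] by (simp add: R_def)
      qed (use \<open>k \<ge> 1\<close> recur in \<open>auto simp: T_def \<epsilon>_def S_def\<close>)
      then obtain z where z: "z \<in> lattice" "X < height z"
          "\<forall>j\<in>{1..k}. \<exists>n>0. quot (b j) z n = 0 \<and> (\<forall>l<n. digit (b j) z l \<noteq> d j)" by blast
      have "misses_digit \<Omega> (b j) (d j) z" if j: "j \<in> {1..k}" for j
        using z(1,3) b b_nz[OF j] j misses_digitI[of "b j" z] by (metis lattice_eq)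
      then show ?thesis using z(1,2) lattice_eq by blast
    qed
    show "infinite {z \<in> integers_of TYPE('a). \<forall>j\<in>{1..k}. misses_digit \<Omega> (b j) (d j) z}" (is "infinite ?Z")
    proof
      assume "finite ?Z"
      then have "height z \<le> Max (height ` ?Z)" if "z \<in> ?Z" for z using that by (intro Max_ge) auto
      then show False using large[of "Max (height ` ?Z)"] by (meson not_less)
    qed
  qed
qed

end

theorem theorem1p3:
  fixes \<Omega> :: "'a::field_char_0 set" and k :: nat
  assumes "number_field TYPE('a)"
    and "\<exists>\<phi>. euclidean_domain (ring_of_integers TYPE('a)) \<phi>"
    and "integral_basis \<Omega>"
    and "k \<ge> 2"
  shows "\<exists>M::real. M > 0 \<and>
    (\<forall>b d :: nat \<Rightarrow> 'a.
       inj_on b {1..k} \<and>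
       (\<forall>j\<in>{1..k}. b j \<in> integers_of TYPE('a) \<and> equal_norm_embeddings (b j) \<and>
          norm (field_norm (b j)) \<ge> M \<and> d j \<in> digit_set \<Omega> (b j)) \<longrightarrow>
       infinite {z \<in> integers_of TYPE('a). \<forall>j\<in>{1..k}. misses_digit \<Omega> (b j) (d j) z})"
proof (cases "finite (embeddings :: ('a \<Rightarrow> complex) set) \<and> (embeddings :: ('a \<Rightarrow> complex) set) \<noteq> {}")
  case True
  obtain \<phi> where "euclidean_domain (ring_of_integers TYPE('a)) \<phi>" using assms(2) by blast
  then interpret E: euclidean_domain "ring_of_integers TYPE('a)" \<phi> .
  \<comment> \<open>Closure under products is read off from the ring structure.\<close>
  have "x * y \<in> integers_of TYPE('a)" if "x \<in> integers_of TYPE('a)" "y \<in> integers_of TYPE('a)" for x y :: 'a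
    using E.m_closed[of x y] that by (simp add: ring_of_integers_def)
  then interpret number_field_basis \<Omega>
    using assms True by unfold_locales auto
  obtain M where "M > 0" "\<And>b d :: nat \<Rightarrow> 'a.
      (\<forall>j\<in>{1..k}. b j \<in> integers_of TYPE('a) \<and> equal_norm_embeddings (b j) \<and> norm (field_norm (b j)) \<ge> M)
      \<Longrightarrow> infinite {z \<in> integers_of TYPE('a). \<forall>j\<in>{1..k}. misses_digit \<Omega> (b j) (d j) z}"
    using infinitely_many_missing[of k] assms(4) by auto
  then show ?thesis by (intro exI[of _ M]) simp
next
  case False
  \<comment> \<open>A product over an empty or infinite set is 1, so \<open>M = 2\<close> makes the
    hypothesis on the bases unsatisfiable.\<close>
  then have "field_norm x = 1" for x :: 'a by (auto simp: field_norm_def)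
  then have "\<not> norm (field_norm x) \<ge> 2" for x :: 'a by simp
  moreover have "1 \<in> {1..k}" using assms(4) by simp
  ultimately show ?thesis by (intro exI[of _ 2] conjI) (simp, blast)
qed

end
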